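(* (i) Let $(Q,E,\mathcal{F},\mathcal{D},\mathcal{P})$ be an Onsager system whose dissipation potential $\mathcal{D}:E\to\mathbb{R}$ is (fiber-wise) quadratic and whose process mapping $\mathcal{P}:E\to TQ$ is surjective. Then solutions $t\mapsto q(t)$ to Onsager's variational principle are gradient flows on $Q$: $$\dot q(t)=-\mathcal{P}_{q(t)}\,\sharp_{q(t)}\,\mathcal{P}_{q(t)}^{\top}\,d\mathcal{F}_{q(t)}=-\mathrm{grad}_h\mathcal{F}\big|_{q(t)},$$ where $h$ is the metric on $Q$ whose inverse metric on $T^*Q$ is $h^{-1}(\omega_1,\omega_2)=g^{-1}(\mathcal{P}^{\top}\omega_1,\mathcal{P}^{\top}\omega_2)$. (ii) Conversely, let $h$ be a metric on $Q$ and let $q$ be any sufficiently regular solution of the gradient flow $\dot q=-\mathrm{grad}_h\mathcal{F}|_{q}$ of a differentiable functional $\mathcal{F}:Q\to\mathbb{R}$. Then $q$ satisfies Onsager's variational principle with the choices $E=TQ$, $\mathcal{D}_q(w)=\tfrac12|w|_h^2=\tfrac12 h(w,w)$, and $\mathcal{P}=I$ (the identity).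
   Context: An Onsager system $(Q,E,\mathcal{F},\mathcal{D},\mathcal{P})$ consists of: a finite- or infinite-dimensional configuration manifold $Q$; a vector bundle $E\to Q$ with fibers $E_q$; a differentiable free energy $\mathcal{F}:Q\to\mathbb{R}$; a dissipation potential $\mathcal{D}:E\to[0,\infty)$ with $\mathcal{D}_q=\mathcal{D}|_{E_q}$ convex and $\mathcal{D}_q(0)=0$; and a fiber-wise linear bundle homomorphism $\mathcal{P}:E\to TQ$ over $Q$. With the evaluation pairing $\langle\cdot\,|\,\cdot\rangle$, the Rayleighian is $\mathcal{R}_q(w)=\langle d\mathcal{F}_q\,|\,\mathcal{P}_qw\rangle+\mathcal{D}_q(w)$ for $w\in E_q$. A differentiable curve $q$ in $Q$ is a solution to (satisfies) Onsager's variational principle (OVP) if for every $t$, $\dot q(t)=\mathcal{P}_{q(t)}v$ with $v=\operatorname{argmin}_{w\in E_{q(t)}}\mathcal{R}_{q(t)}(w)$. Quadratic dissipation: the fiber derivative $\flat_q=\partial_w\mathcal{D}_q:E_q\to E_q^*$ is linear, symmetric, positive definite and an isomorphism, and $\mathcal{D}_q(w)=\tfrac12\langle\flat_q w\,|\,w\rangle$. Set $\sharp_q=\flat_q^{-1}:E_q^*\to E_q$, $g(w_1,w_2)=\langle\flat_q w_1\,|\,w_2\rangle$ (a fiber-wise inner product on $E$), and let $g^{-1}$ be the inner product on $E_q^*$ with $g^{-1}(\flat_q w_1,\flat_q w_2)=g(w_1,w_2)$. The map $\mathcal{P}_q^\top:T_q^*Q\to E_q^*$ is the transpose of $\mathcal{P}_q$.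 A metric $h$ on $Q$ is a symmetric positive definite fiber-wise bilinear form on $TQ$ whose induced map $T_qQ\to T_q^*Q$, $u\mapsto h(u,\cdot)$, is an isomorphism for each $q$; $\mathrm{grad}_h\mathcal{F}$ is defined by $h(\mathrm{grad}_h\mathcal{F}|_q,u)=\langle d\mathcal{F}_q\,|\,u\rangle$ for all $u\in T_qQ$. In the infinite-dimensional case duals are continuous duals and bundle maps are continuous on (complete) fibers. "Sufficiently regular" means that the curve is differentiable and all of these objects exist. *)

theory Defs
  imports "HOL-Analysis.Analysis"
begin

section \<open>Banach manifolds\<close>

text \<open>
  Manifolds are modelled on a Banach space \<open>'b\<close>, so that finite and infinite dimensions are
  treated uniformly.  The point set is a carrier, \<open>topspace (mtop M)\<close>.  The values of a
  chart outside its domain play no role.  Differentiability class \<open>C\<^sup>1\<close> is what tangent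
  spaces, differentiable functions and differentiable curves need; smooth manifolds are included.
\<close>

type_synonym ('q, 'b) chart = "'q set \<times> ('q \<Rightarrow> 'b)"

record ('q, 'b) manifold =
  mtop :: "'q topology"
  charts :: "('q, 'b) chart set"

abbreviation points :: "('q, 'b) manifold \<Rightarrow> 'q set" where
  "points M \<equiv> topspace (mtop M)"

definition charts_at :: "('q, 'b) manifold \<Rightarrow> 'q \<Rightarrow> ('q, 'b) chart set" where
  "charts_at M q = {c \<in> charts M. q \<in> fst c}"

definition C1_on :: "'a::real_normed_vector set \<Rightarrow> ('a \<Rightarrow> 'b::real_normed_vector) \<Rightarrow> bool" where
  "C1_on S f \<longleftrightarrow>
     (\<exists>f' :: 'a \<Rightarrow> 'a \<Rightarrow>\<^sub>L 'b.
        (\<forall>x\<in>S. (f has_derivative blinfun_apply (f' x)) (at x)) \<and> continuous_on S f')"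

definition banach_manifold :: "('q, 'b::banach) manifold \<Rightarrow> bool" where
  "banach_manifold M \<longleftrightarrow>
     Hausdorff_space (mtop M) \<and>
     (\<forall>q\<in>points M. charts_at M q \<noteq> {}) \<and>
     (\<forall>(U, \<phi>)\<in>charts M. openin (mtop M) U \<and> open (\<phi> ` U) \<and>
        homeomorphic_map (subtopology (mtop M) U) (top_of_set (\<phi> ` U)) \<phi>) \<and>
     (\<forall>(U, \<phi>)\<in>charts M. \<forall>(V, \<psi>)\<in>charts M. C1_on (\<phi> ` (U \<inter> V)) (\<psi> \<circ> inv_into U \<phi>))"


section \<open>Vector bundles\<close>

text \<open>
  A vector bundle is given by its family of fibres \<open>fib E q\<close> with their vector space
  operations, and by local trivialisations \<open>(U, \<tau>)\<close>, where \<open>\<tau> q\<close> is the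
  isomorphism from the fibre over \<open>q \<in> U\<close> to the Banach space \<open>'f\<close>.  The total space is
  the disjoint union \<open>Sigma (points M) (fib E)\<close>; the fibres need not be disjoint as sets.
  The topologies of the total space and of the fibres are those induced by the trivialisations.
\<close>

record ('q, 'e, 'f) vbundle =
  fib :: "'q \<Rightarrow> 'e set"
  fzero :: "'q \<Rightarrow> 'e"
  fadd :: "'q \<Rightarrow> 'e \<Rightarrow> 'e \<Rightarrow> 'e"
  fscale :: "'q \<Rightarrow> real \<Rightarrow> 'e \<Rightarrow> 'e"
  trivs :: "('q set \<times> ('q \<Rightarrow> 'e \<Rightarrow> 'f)) set"

definition trivs_at :: "('q, 'e, 'f) vbundle \<Rightarrow> 'q \<Rightarrow> ('e \<Rightarrow> 'f) set" where
  "trivs_at E q = {\<tau> q |U \<tau>. (U, \<tau>) \<in> trivs E \<and> q \<in> U}"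

text \<open>Joint continuity of a fibre-preserving map in all local trivialisations, that is,
  continuity as a map of total spaces.\<close>

definition bundle_continuous ::
    "'q topology \<Rightarrow> ('q, 'e, 'f::real_normed_vector) vbundle \<Rightarrow>
     ('q, 'd, 'g::real_normed_vector) vbundle \<Rightarrow> ('q \<Rightarrow> 'e \<Rightarrow> 'd) \<Rightarrow> bool" where
  "bundle_continuous X E E' P \<longleftrightarrow>
     (\<forall>(U, \<tau>)\<in>trivs E. \<forall>(V, \<sigma>)\<in>trivs E'.
        continuous_map (prod_topology (subtopology X (U \<inter> V)) euclidean) euclidean
          (\<lambda>(q, x). \<sigma> q (P q (inv_into (fib E q) (\<tau> q) x))))"

text \<open>The last condition says that the transition maps between trivialisations are continuous.\<close>

definition vector_bundle :: "'q topology \<Rightarrow> ('q, 'e, 'f::banach) vbundle \<Rightarrow> bool" where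
  "vector_bundle X E \<longleftrightarrow>
     (\<forall>q\<in>topspace X. trivs_at E q \<noteq> {}) \<and>
     (\<forall>(U, \<tau>)\<in>trivs E. openin X U) \<and>
     (\<forall>q\<in>topspace X. fzero E q \<in> fib E q \<and>
        (\<forall>u\<in>fib E q. \<forall>v\<in>fib E q. fadd E q u v \<in> fib E q) \<and>
        (\<forall>a. \<forall>u\<in>fib E q. fscale E q a u \<in> fib E q)) \<and>
     (\<forall>q\<in>topspace X. \<forall>\<tau>\<in>trivs_at E q.
        bij_betw \<tau> (fib E q) UNIV \<and>
        \<tau> (fzero E q) = 0 \<and>
        (\<forall>u\<in>fib E q. \<forall>v\<in>fib E q. \<tau> (fadd E q u v) = \<tau> u + \<tau> v) \<and>
        (\<forall>a. \<forall>u\<in>fib E q. \<tau> (fscale E q a u) = a *\<^sub>R \<tau> u)) \<and>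
     bundle_continuous X E E (\<lambda>q w. w)"

definition bundle_hom ::
    "'q topology \<Rightarrow> ('q, 'e, 'f::banach) vbundle \<Rightarrow> ('q, 'd, 'g::banach) vbundle \<Rightarrow>
     ('q \<Rightarrow> 'e \<Rightarrow> 'd) \<Rightarrow> bool" where
  "bundle_hom X E E' P \<longleftrightarrow>
     (\<forall>q\<in>topspace X. P q \<in> fib E q \<rightarrow> fib E' q \<and>
        (\<forall>u\<in>fib E q. \<forall>v\<in>fib E q. P q (fadd E q u v) = fadd E' q (P q u) (P q v)) \<and>
        (\<forall>a. \<forall>u\<in>fib E q. P q (fscale E q a u) = fscale E' q a (P q u))) \<and>
     bundle_continuous X E E' P"

text \<open>Continuous dual of a fibre.  Functionals are extensional functions, so that equality
  of functionals is equality in HOL; linearity is that of the local representatives.\<close>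

definition dual :: "('q, 'e, 'f::real_normed_vector) vbundle \<Rightarrow> 'q \<Rightarrow> ('e \<Rightarrow> real) set" where
  "dual E q =
     {l \<in> extensional (fib E q). \<forall>\<tau>\<in>trivs_at E q. bounded_linear (\<lambda>x. l (inv_into (fib E q) \<tau> x))}"

definition transpose_at ::
    "('q, 'e, 'f) vbundle \<Rightarrow> ('q \<Rightarrow> 'e \<Rightarrow> 'd) \<Rightarrow> 'q \<Rightarrow> ('d \<Rightarrow> real) \<Rightarrow> 'e \<Rightarrow> real" where
  "transpose_at E P q \<omega> = (\<lambda>w\<in>fib E q. \<omega> (P q w))"

text \<open>
  A symmetric positive definite continuous bilinear form \<open>b\<close> on a fibre, in curried form:
  \<open>b u \<in> dual E q\<close> is the functional \<open>b(u, \<cdot>)\<close>, so \<open>b\<close> is at the same time the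
  induced map into the dual, which is required to be an isomorphism.  Its continuity is the
  boundedness of the bilinear form; continuity of the inverse is then automatic (Banach).
\<close>

definition inner_iso :: "('q, 'e, 'f::real_normed_vector) vbundle \<Rightarrow> 'q \<Rightarrow> ('e \<Rightarrow> 'e \<Rightarrow> real) \<Rightarrow> bool" where
  "inner_iso E q b \<longleftrightarrow>
     b \<in> fib E q \<rightarrow>\<^sub>E dual E q \<and>
     (\<forall>\<tau>\<in>trivs_at E q.
        bounded_bilinear (\<lambda>x y. b (inv_into (fib E q) \<tau> x) (inv_into (fib E q) \<tau> y))) \<and>
     (\<forall>u\<in>fib E q. \<forall>v\<in>fib E q. b u v = b v u) \<and>
     (\<forall>u\<in>fib E q. u \<noteq> fzero E q \<longrightarrow> b u u > 0) \<and>
     bij_betw b (fib E q) (dual E q)"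

definition inverse_form ::
    "('q, 'e, 'f) vbundle \<Rightarrow> 'q \<Rightarrow> ('e \<Rightarrow> 'e \<Rightarrow> real) \<Rightarrow> ('e \<Rightarrow> real) \<Rightarrow> ('e \<Rightarrow> real) \<Rightarrow> real" where
  "inverse_form E q b \<alpha> \<beta> = b (inv_into (fib E q) b \<alpha>) (inv_into (fib E q) b \<beta>)"


section \<open>Tangent bundle, differentials and velocities\<close>

text \<open>A tangent vector at \<open>q\<close> is the family of its coordinate vectors in the charts around
  \<open>q\<close>, related by the derivatives of the chart transitions.\<close>

definition tangent_space :: "('q, 'b::real_normed_vector) manifold \<Rightarrow> 'q \<Rightarrow> (('q, 'b) chart \<Rightarrow> 'b) set" where
  "tangent_space M q =
     {v \<in> extensional (charts_at M q).
        \<forall>(U, \<phi>)\<in>charts_at M q. \<forall>(V, \<psi>)\<in>charts_at M q.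
          v (V, \<psi>) = frechet_derivative (\<psi> \<circ> inv_into U \<phi>) (at (\<phi> q)) (v (U, \<phi>))}"

definition tangent_bundle ::
    "('q, 'b::real_normed_vector) manifold \<Rightarrow> ('q, ('q, 'b) chart \<Rightarrow> 'b, 'b) vbundle" where
  "tangent_bundle M =
     \<lparr> fib = tangent_space M,
       fzero = (\<lambda>q. \<lambda>c\<in>charts_at M q. 0),
       fadd = (\<lambda>q u v. \<lambda>c\<in>charts_at M q. u c + v c),
       fscale = (\<lambda>q a u. \<lambda>c\<in>charts_at M q. a *\<^sub>R u c),
       trivs = (\<lambda>(U, \<phi>). (U, \<lambda>q v. v (U, \<phi>))) ` charts M \<rparr>"

definition has_differential ::
    "('q, 'b::real_normed_vector) manifold \<Rightarrow> ('q \<Rightarrow> real) \<Rightarrow> 'q \<Rightarrow>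
     ((('q, 'b) chart \<Rightarrow> 'b) \<Rightarrow> real) \<Rightarrow> bool" where
  "has_differential M F q l \<longleftrightarrow>
     l \<in> dual (tangent_bundle M) q \<and>
     (\<forall>(U, \<phi>)\<in>charts_at M q.
        ((F \<circ> inv_into U \<phi>) has_derivative
          (\<lambda>x. l (inv_into (tangent_space M q) (\<lambda>v. v (U, \<phi>)) x))) (at (\<phi> q)))"

definition differential ::
    "('q, 'b::real_normed_vector) manifold \<Rightarrow> ('q \<Rightarrow> real) \<Rightarrow> 'q \<Rightarrow>
     (('q, 'b) chart \<Rightarrow> 'b) \<Rightarrow> real" where
  "differential M F q = (THE l. has_differential M F q l)"

definition differentiable_functional :: "('q, 'b::real_normed_vector) manifold \<Rightarrow> ('q \<Rightarrow> real) \<Rightarrow> bool" where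
  "differentiable_functional M F \<longleftrightarrow> (\<forall>q\<in>points M. \<exists>l. has_differential M F q l)"

text \<open>Curves live on an arbitrary nondegenerate interval, with one-sided derivatives at
  endpoints belonging to it.\<close>

definition differentiable_curve ::
    "('q, 'b::real_normed_vector) manifold \<Rightarrow> real set \<Rightarrow> (real \<Rightarrow> 'q) \<Rightarrow> bool" where
  "differentiable_curve M I \<gamma> \<longleftrightarrow>
     is_interval I \<and> (\<exists>a\<in>I. \<exists>b\<in>I. a < b) \<and>
     continuous_map (top_of_set I) (mtop M) \<gamma> \<and>
     (\<forall>t\<in>I. \<forall>(U, \<phi>)\<in>charts_at M (\<gamma> t). (\<phi> \<circ> \<gamma>) differentiable (at t within I))"

definition velocity ::
    "('q, 'b::real_normed_vector) manifold \<Rightarrow> real set \<Rightarrow> (real \<Rightarrow> 'q) \<Rightarrow> real \<Rightarrow> ('q, 'b) chart \<Rightarrow> 'b" where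
  "velocity M I \<gamma> t =
     (\<lambda>(U, \<phi>)\<in>charts_at M (\<gamma> t). vector_derivative (\<phi> \<circ> \<gamma>) (at t within I))"


section \<open>Metrics and gradient flows\<close>

text \<open>No regularity of the metric in the base point is imposed.\<close>

definition metric_on ::
    "('q, 'b::real_normed_vector) manifold \<Rightarrow>
     ('q \<Rightarrow> (('q, 'b) chart \<Rightarrow> 'b) \<Rightarrow> (('q, 'b) chart \<Rightarrow> 'b) \<Rightarrow> real) \<Rightarrow> bool" where
  "metric_on M h \<longleftrightarrow>
     h \<in> extensional (points M) \<and> (\<forall>q\<in>points M. inner_iso (tangent_bundle M) q (h q))"

definition gradient ::
    "('q, 'b::real_normed_vector) manifold \<Rightarrow>
     ('q \<Rightarrow> (('q, 'b) chart \<Rightarrow> 'b) \<Rightarrow> (('q, 'b) chart \<Rightarrow> 'b) \<Rightarrow> real) \<Rightarrow>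
     ('q \<Rightarrow> real) \<Rightarrow> 'q \<Rightarrow> ('q, 'b) chart \<Rightarrow> 'b" where
  "gradient M h F q =
     (THE v. v \<in> tangent_space M q \<and> (\<forall>u\<in>tangent_space M q. h q v u = differential M F q u))"

definition neg_tangent ::
    "('q, 'b::real_normed_vector) manifold \<Rightarrow> 'q \<Rightarrow> (('q, 'b) chart \<Rightarrow> 'b) \<Rightarrow> ('q, 'b) chart \<Rightarrow> 'b" where
  "neg_tangent M q v = fscale (tangent_bundle M) q (-1) v"

definition gradient_flow ::
    "('q, 'b::real_normed_vector) manifold \<Rightarrow>
     ('q \<Rightarrow> (('q, 'b) chart \<Rightarrow> 'b) \<Rightarrow> (('q, 'b) chart \<Rightarrow> 'b) \<Rightarrow> real) \<Rightarrow>
     ('q \<Rightarrow> real) \<Rightarrow> real set \<Rightarrow> (real \<Rightarrow> 'q) \<Rightarrow> bool" where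
  "gradient_flow M h F I \<gamma> \<longleftrightarrow>
     differentiable_curve M I \<gamma> \<and>
     (\<forall>t\<in>I. velocity M I \<gamma> t = neg_tangent M (\<gamma> t) (gradient M h F (\<gamma> t)))"


section \<open>Onsager systems\<close>

definition onsager_system ::
    "('q, 'b::banach) manifold \<Rightarrow> ('q, 'e, 'f::banach) vbundle \<Rightarrow> ('q \<Rightarrow> real) \<Rightarrow>
     ('q \<Rightarrow> 'e \<Rightarrow> real) \<Rightarrow> ('q \<Rightarrow> 'e \<Rightarrow> ('q, 'b) chart \<Rightarrow> 'b) \<Rightarrow> bool" where
  "onsager_system M E F D P \<longleftrightarrow>
     banach_manifold M \<and>
     vector_bundle (mtop M) E \<and>
     differentiable_functional M F \<and>
     (\<forall>q\<in>points M.
        (\<forall>w\<in>fib E q. D q w \<ge> 0) \<and>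
        D q (fzero E q) = 0 \<and>
        (\<forall>u\<in>fib E q. \<forall>v\<in>fib E q. \<forall>s\<in>{0..1}.
           D q (fadd E q (fscale E q (1 - s) u) (fscale E q s v)) \<le> (1 - s) * D q u + s * D q v)) \<and>
     bundle_hom (mtop M) E (tangent_bundle M) P"

definition rayleighian ::
    "('q, 'b::real_normed_vector) manifold \<Rightarrow> ('q \<Rightarrow> real) \<Rightarrow>
     ('q \<Rightarrow> 'e \<Rightarrow> real) \<Rightarrow> ('q \<Rightarrow> 'e \<Rightarrow> ('q, 'b) chart \<Rightarrow> 'b) \<Rightarrow> 'q \<Rightarrow> 'e \<Rightarrow> real" where
  "rayleighian M F D P q w = differential M F q (P q w) + D q w"

definition satisfies_OVP ::
    "('q, 'b::real_normed_vector) manifold \<Rightarrow> ('q, 'e, 'f) vbundle \<Rightarrow> ('q \<Rightarrow> real) \<Rightarrow>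
     ('q \<Rightarrow> 'e \<Rightarrow> real) \<Rightarrow> ('q \<Rightarrow> 'e \<Rightarrow> ('q, 'b) chart \<Rightarrow> 'b) \<Rightarrow> real set \<Rightarrow> (real \<Rightarrow> 'q) \<Rightarrow> bool" where
  "satisfies_OVP M E F D P I \<gamma> \<longleftrightarrow>
     differentiable_curve M I \<gamma> \<and>
     (\<forall>t\<in>I. \<exists>v. is_arg_min (rayleighian M F D P (\<gamma> t)) (\<lambda>w. w \<in> fib E (\<gamma> t)) v \<and>
        velocity M I \<gamma> t = P (\<gamma> t) v)"

definition has_fiber_derivative ::
    "('q, 'e, 'f::real_normed_vector) vbundle \<Rightarrow> ('q \<Rightarrow> 'e \<Rightarrow> real) \<Rightarrow> 'q \<Rightarrow> 'e \<Rightarrow> ('e \<Rightarrow> real) \<Rightarrow> bool" where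
  "has_fiber_derivative E D q w l \<longleftrightarrow>
     l \<in> dual E q \<and>
     (\<forall>\<tau>\<in>trivs_at E q.
        ((\<lambda>x. D q (inv_into (fib E q) \<tau> x)) has_derivative
          (\<lambda>x. l (inv_into (fib E q) \<tau> x))) (at (\<tau> w)))"

definition flat ::
    "('q, 'e, 'f::real_normed_vector) vbundle \<Rightarrow> ('q \<Rightarrow> 'e \<Rightarrow> real) \<Rightarrow> 'q \<Rightarrow> 'e \<Rightarrow> 'e \<Rightarrow> real" where
  "flat E D q = (\<lambda>w\<in>fib E q. THE l. has_fiber_derivative E D q w l)"

definition sharp ::
    "('q, 'e, 'f::real_normed_vector) vbundle \<Rightarrow> ('q \<Rightarrow> 'e \<Rightarrow> real) \<Rightarrow> 'q \<Rightarrow> ('e \<Rightarrow> real) \<Rightarrow> 'e" where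
  "sharp E D q = inv_into (fib E q) (flat E D q)"

text \<open>In curried form the inner product \<open>g(w\<^sub>1, w\<^sub>2) = \<langle>\<flat> w\<^sub>1 | w\<^sub>2\<rangle>\<close> is \<open>flat E D q\<close> itself.\<close>

definition quadratic_dissipation ::
    "'q set \<Rightarrow> ('q, 'e, 'f::real_normed_vector) vbundle \<Rightarrow> ('q \<Rightarrow> 'e \<Rightarrow> real) \<Rightarrow> bool" where
  "quadratic_dissipation Q E D \<longleftrightarrow>
     (\<forall>q\<in>Q.
        (\<forall>w\<in>fib E q. \<exists>l. has_fiber_derivative E D q w l) \<and>
        inner_iso E q (flat E D q) \<and>
        (\<forall>w\<in>fib E q. D q w = 1/2 * flat E D q w w))"

definition surjective_process ::
    "('q, 'b::real_normed_vector) manifold \<Rightarrow> ('q, 'e, 'f) vbundle \<Rightarrow>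
     ('q \<Rightarrow> 'e \<Rightarrow> ('q, 'b) chart \<Rightarrow> 'b) \<Rightarrow> bool" where
  "surjective_process M E P \<longleftrightarrow> (\<forall>q\<in>points M. P q ` fib E q = tangent_space M q)"

text \<open>The metric on the manifold with inverse
  \<open>h\<^sup>-\<^sup>1(\<omega>\<^sub>1, \<omega>\<^sub>2) = g\<^sup>-\<^sup>1(P\<^sup>T \<omega>\<^sub>1, P\<^sup>T \<omega>\<^sub>2)\<close>.\<close>

definition onsager_metric ::
    "('q, 'b::real_normed_vector) manifold \<Rightarrow> ('q, 'e, 'f::real_normed_vector) vbundle \<Rightarrow>
     ('q \<Rightarrow> 'e \<Rightarrow> real) \<Rightarrow> ('q \<Rightarrow> 'e \<Rightarrow> ('q, 'b) chart \<Rightarrow> 'b) \<Rightarrow>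
     ('q \<Rightarrow> (('q, 'b) chart \<Rightarrow> 'b) \<Rightarrow> (('q, 'b) chart \<Rightarrow> 'b) \<Rightarrow> real) \<Rightarrow> bool" where
  "onsager_metric M E D P h \<longleftrightarrow>
     metric_on M h \<and>
     (\<forall>q\<in>points M. \<forall>\<omega>\<^sub>1\<in>dual (tangent_bundle M) q. \<forall>\<omega>\<^sub>2\<in>dual (tangent_bundle M) q.
        inverse_form (tangent_bundle M) q (h q) \<omega>\<^sub>1 \<omega>\<^sub>2 =
        inverse_form E q (flat E D q) (transpose_at E P q \<omega>\<^sub>1) (transpose_at E P q \<omega>\<^sub>2))"

end

theory Submission
  imports Defs
begin

text \<open>
  The statement is one about a single fibre.  Write \<open>g\<close> for the dissipation form on the fibre
  \<open>E\<^sub>q\<close> and \<open>a = \<sharp> P\<^sup>T dF\<close>.  Completing the square, the Rayleighian is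
  \<open>dF (P w) + g w w / 2 = g (w + a) (w + a) / 2 - g a a / 2\<close>, so its only minimiser is
  \<open>- a\<close> and the principle says that the velocity is \<open>- P \<sharp> P\<^sup>T dF\<close>
  (\<open>is_arg_min_linear_plus_half_form\<close>).  The converse is the same computation with \<open>P\<close> the
  identity of the tangent bundle; what has to be added there is that the tangent bundle is a vector
  bundle, which follows from the chain rule for chart transitions and their continuous
  differentiability (\<open>tangent_bundle_vector_bundle\<close>).

  It remains to recognise \<open>P \<sharp> P\<^sup>T dF\<close> as a gradient.  If a metric \<open>h\<close> has inverse
  \<open>h\<^sup>-\<^sup>1(\<omega>\<^sub>1, \<omega>\<^sub>2) = g\<^sup>-\<^sup>1(P\<^sup>T \<omega>\<^sub>1, P\<^sup>T \<omega>\<^sub>2)\<close>, then every \<open>\<omega>\<^sub>1\<close> takes the same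
  value on the vector representing \<open>\<omega>\<^sub>2\<close> and on \<open>P \<sharp> P\<^sup>T \<omega>\<^sub>2\<close>.  As functionals separate
  points, these vectors agree (\<open>push_forward_riesz\<close>), which gives both the gradient formula and
  the uniqueness of \<open>h\<close>.

  Existence of \<open>h\<close> is where surjectivity of \<open>P\<close> and completeness enter.  The metric is
  the quotient metric \<open>h u v = g (s u) (s v)\<close>, where \<open>s u\<close> is the preimage of
  \<open>u\<close> orthogonal to the kernel of \<open>P\<close> (\<open>quotient_hilbert_form\<close>).  Preimages of
  least norm exist because \<open>g\<close> is coercive, and \<open>h\<close> is bounded because preimages can be
  chosen with controlled norm; both are consequences of Banach's open mapping theorem, applied to
  the map \<open>w \<mapsto> g w\<close> onto the dual of the fibre and to \<open>P\<close>.
\<close>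

section \<open>The open mapping theorem\<close>

lemma bounded_linear_if_continuous_at_0:
  fixes f :: "'a::real_normed_vector \<Rightarrow> 'b::real_normed_vector"
  assumes "linear f" "isCont f 0"
  shows "bounded_linear f"
proof -
  interpret linear f by fact
  have "\<exists>d>0. \<forall>x. dist x 0 < d \<longrightarrow> dist (f x) (f 0) < 1"
    using assms(2) unfolding continuous_at_eps_delta by (metis zero_less_one)
  then obtain d where d: "d > 0" "\<And>x. norm x < d \<Longrightarrow> norm (f x) < 1"
    by (auto simp: zero)
  have "norm (f x) \<le> norm x * (2 / d)" for x
  proof (cases "x = 0")
    case False
    let ?a = "d / (2 * norm x)"
    have "norm (f (?a *\<^sub>R x)) < 1"
      using d(1) False by (intro d(2)) simp
    then show ?thesis
      using d(1) False by (simp add: scaleR field_simps)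
  qed (simp add: zero)
  then show ?thesis
    by (intro bounded_linear_intro[of f "2 / d"] add scaleR)
qed

text \<open>By Baire's theorem the closure of the image of some ball has interior, and differences of
  points of that image approximate every small vector.  The error \<open>norm y / 2\<close> is what lets the
  approximation be iterated.\<close>
lemma open_mapping_approximate:
  fixes T :: "'a::banach \<Rightarrow> 'b::banach"
  assumes "bounded_linear T" "surj T"
  obtains c where "c > 0" "\<And>y. \<exists>x. norm x \<le> c * norm y \<and> norm (y - T x) \<le> norm y / 2"
proof -
  interpret bounded_linear T by fact
  let ?G = "\<lambda>n::nat. closure (T ` cball 0 (real n))"
  have "\<exists>n. interior (?G n) \<noteq> {}"
  proof (rule ccontr)
    assume "\<not> ?thesis"
    then have "euclidean interior_of (\<Union>(range ?G)) = {}"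
      by (intro Baire_category_alt)
        (auto simp: completely_metrizable_space_euclidean simp flip: interior_of_eq)
    moreover have "\<Union>(range ?G) = UNIV"
    proof -
      have "\<exists>n. y \<in> ?G n" for y
      proof -
        obtain x where x: "y = T x" using assms(2) by blast
        obtain n where "norm x \<le> real n" using real_arch_simple by blast
        then have "y \<in> T ` cball 0 (real n)" using x by simp
        then show ?thesis using closure_subset by blast
      qed
      then show ?thesis by blast
    qed
    ultimately show False by simp
  qed
  then obtain n y0 r where r: "r > 0" "ball y0 r \<subseteq> ?G n"
    by (metis all_not_in_conv interior_subset mem_interior)
  have near: "\<exists>x. norm x \<le> 2 * real n \<and> norm (y - T x) \<le> e"
    if y: "norm y < r" and e: "e > 0" for y e
  proof -
    have "y0 + y \<in> ?G n" "y0 \<in> ?G n"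
      using y r by (auto simp: subset_iff dist_norm)
    then obtain x1 x2 where x: "norm x1 \<le> real n" "norm x2 \<le> real n"
        "dist (T x1) (y0 + y) < e/2" "dist (T x2) y0 < e/2"
      using e unfolding closure_approachable by (auto dest!: spec[of _ "e/2"])
    have "y - T (x1 - x2) = (T x2 - y0) - (T x1 - (y0 + y))"
      by (simp add: diff)
    then have "norm (y - T (x1 - x2)) \<le> norm (T x2 - y0) + norm (T x1 - (y0 + y))"
      by (metis norm_triangle_ineq4)
    then have "norm (y - T (x1 - x2)) \<le> e"
      using x by (simp add: dist_norm)
    moreover have "norm (x1 - x2) \<le> 2 * real n"
      using norm_triangle_ineq4[of x1 x2] x by simp
    ultimately show ?thesis by blast
  qed
  show thesis
  proof
    show "4 * real n / r + 1 > 0"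
      using r by (simp add: add_nonneg_pos)
    show "\<exists>x. norm x \<le> (4 * real n / r + 1) * norm y \<and> norm (y - T x) \<le> norm y / 2" for y
    proof (cases "y = 0")
      case True
      then show ?thesis by (intro exI[of _ 0]) (simp add: zero)
    next
      case False
      define a where "a = r / (2 * norm y)"
      have a: "a > 0" using False r by (simp add: a_def)
      have "norm (a *\<^sub>R y) < r" using False r by (simp add: a_def)
      then obtain x where x: "norm x \<le> 2 * real n" "norm (a *\<^sub>R y - T x) \<le> r / 4"
        using near[of "a *\<^sub>R y" "r/4"] r by auto
      have "y - T (x /\<^sub>R a) = (a *\<^sub>R y - T x) /\<^sub>R a"
        using a by (simp add: scaleR scaleR_diff_right)
      then have "norm (y - T (x /\<^sub>R a)) = norm (a *\<^sub>R y - T x) / a"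
        using a by (simp add: divide_inverse)
      also have "\<dots> \<le> (r / 4) / a"
        using x a by (intro divide_right_mono) auto
      also have "\<dots> = norm y / 2"
        using False r by (simp add: a_def)
      finally have 1: "norm (y - T (x /\<^sub>R a)) \<le> norm y / 2" .
      have "norm (x /\<^sub>R a) = norm x / a"
        using a by (simp add: divide_inverse)
      also have "\<dots> \<le> (2 * real n) / a"
        using x a by (intro divide_right_mono) auto
      also have "\<dots> = 4 * real n / r * norm y"
        using False r by (simp add: a_def)
      also have "\<dots> \<le> (4 * real n / r + 1) * norm y"
        by (simp add: distrib_right)
      finally show ?thesis using 1 by blast
    qed
  qed
qed

text \<open>Banach's theorem in the quantitative form used below: preimages can be chosen with norm
  controlled by the image.  The preimage is the sum of the corrections obtained by applying the
  approximate version to the successive errors, which shrink geometrically.\<close>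
theorem open_mapping:
  fixes T :: "'a::banach \<Rightarrow> 'b::banach"
  assumes "bounded_linear T" "surj T"
  obtains C where "C > 0" "\<And>y. \<exists>x. T x = y \<and> norm x \<le> C * norm y"
proof -
  interpret bounded_linear T by fact
  obtain c where c: "c > 0" "\<And>y. \<exists>x. norm x \<le> c * norm y \<and> norm (y - T x) \<le> norm y / 2"
    using open_mapping_approximate assms by blast
  then obtain s where s: "\<And>y. norm (s y) \<le> c * norm y" "\<And>y. norm (y - T (s y)) \<le> norm y / 2"
    by metis
  have "\<exists>x. T x = y \<and> norm x \<le> (2 * c) * norm y" for y
  proof -
    define z where "z k = ((\<lambda>y. y - T (s y)) ^^ k) y" for k
    have z0: "z 0 = y" and zS: "z (Suc k) = z k - T (s (z k))" for k
      by (simp_all add: z_def)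
    have zb: "norm (z k) \<le> norm y * (1/2) ^ k" for k
    proof (induction k)
      case (Suc k)
      then show ?case
        using s(2)[of "z k"] by (simp add: zS)
    qed (simp add: z0)
    have sb: "norm (s (z k)) \<le> c * norm y * (1/2) ^ k" for k
    proof -
      have "norm (s (z k)) \<le> c * norm (z k)" by (rule s)
      also have "\<dots> \<le> c * (norm y * (1/2) ^ k)"
        using c(1) zb by (intro mult_left_mono) auto
      finally show ?thesis by (simp add: mult.assoc)
    qed
    have geo: "(\<lambda>k. c * norm y * (1/2) ^ k) sums (2 * c * norm y)"
      using sums_mult[OF geometric_sums[of "1/2::real"], of "c * norm y"] by (simp add: mult_ac)
    have sn: "summable (\<lambda>k. norm (s (z k)))"
      using sb by (intro summable_comparison_test'[OF sums_summable[OF geo]]) simp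
    have "norm (\<Sum>k. s (z k)) \<le> (\<Sum>k. norm (s (z k)))"
      by (rule summable_norm[OF sn])
    also have "\<dots> \<le> (\<Sum>k. c * norm y * (1/2) ^ k)"
      using sb sn geo by (intro suminf_le) (auto simp: sums_iff)
    also have "\<dots> = 2 * c * norm y"
      using geo by (simp add: sums_iff)
    finally have b: "norm (\<Sum>k. s (z k)) \<le> 2 * c * norm y" .
    have "z \<longlonglongrightarrow> 0"
    proof (rule Lim_null_comparison)
      show "\<forall>\<^sub>F k in sequentially. norm (z k) \<le> norm y * (1/2) ^ k"
        using zb by simp
      show "(\<lambda>k. norm y * (1/2) ^ k) \<longlonglongrightarrow> 0"
        by (intro tendsto_mult_right_zero LIMSEQ_power_zero) simp
    qed
    then have "(\<lambda>k. z k - z (Suc k)) sums (z 0 - 0)"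
      by (rule telescope_sums')
    then have "(\<lambda>k. T (s (z k))) sums y"
      by (simp add: zS z0)
    moreover have "(\<lambda>k. T (s (z k))) sums T (\<Sum>k. s (z k))"
      by (intro sums summable_sums summable_norm_cancel[OF sn])
    ultimately have "T (\<Sum>k. s (z k)) = y"
      by (rule sums_unique2[symmetric])
    then show ?thesis using b by blast
  qed
  then show thesis
    using that[of "2 * c"] c(1) by auto
qed

section \<open>Inner products that represent every bounded functional\<close>

text \<open>A bounded inner product for which the Riesz representation theorem holds.  On a Banach space
  this forces the norm of the form to be equivalent to the given norm
  (\<open>hilbert_form_coercive\<close>), so that the space is a Hilbert space up to equivalence of norms.\<close>
definition hilbert_form :: "('a::real_normed_vector \<Rightarrow> 'a \<Rightarrow> real) \<Rightarrow> bool" where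
  "hilbert_form b \<longleftrightarrow>
     bounded_bilinear b \<and> (\<forall>x y. b x y = b y x) \<and> (\<forall>x. x \<noteq> 0 \<longrightarrow> b x x > 0) \<and>
     (\<forall>l. bounded_linear l \<longrightarrow> (\<exists>x. b x = l))"

lemma
  assumes "hilbert_form b"
  shows hilbert_form_bilinear: "bounded_bilinear b"
    and hilbert_form_sym: "b x y = b y x"
    and hilbert_form_pos: "x \<noteq> 0 \<Longrightarrow> b x x > 0"
    and hilbert_form_riesz: "bounded_linear l \<Longrightarrow> \<exists>x. b x = l"
  using assms unfolding hilbert_form_def by auto

lemma symmetric_square_add:
  assumes "bounded_bilinear b" "\<And>x y. b x y = (b y x :: real)"
  shows "b (x + a *\<^sub>R y) (x + a *\<^sub>R y) = b x x + 2 * a * b x y + a\<^sup>2 * b y y"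
proof -
  interpret bounded_bilinear b by fact
  show ?thesis
    using assms(2)[of x y]
    by (simp add: add_left add_right scaleR_left scaleR_right power2_eq_square algebra_simps)
qed

text \<open>Nonnegativity of \<open>b (x + t y) (x + t y)\<close> at a well chosen \<open>t\<close>: the minimiser when
  \<open>b y y > 0\<close>, and otherwise a \<open>t\<close> at which the expression, then affine in \<open>t\<close>,
  equals \<open>-1\<close> unless \<open>b x y = 0\<close>.\<close>
lemma psd_Cauchy_Schwarz:
  assumes "bounded_bilinear b" "\<And>x y. b x y = (b y x :: real)" "\<And>x. b x x \<ge> 0"
  shows "(b x y)\<^sup>2 \<le> b x x * b y y"
proof (cases "b y y = 0")
  case True
  have "b x y = 0"
  proof (rule ccontr)
    assume n: "b x y \<noteq> 0"
    have "b x x + 2 * (- (b x x + 1) / (2 * b x y)) * b x y \<ge> 0"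
      using symmetric_square_add[OF assms(1,2), of x "- (b x x + 1) / (2 * b x y)" y]
        assms(3)[of "x + (- (b x x + 1) / (2 * b x y)) *\<^sub>R y"] True by simp
    then show False using n by (simp add: field_simps)
  qed
  then show ?thesis using True by simp
next
  case False
  then have p: "b y y > 0" using assms(3)[of y] by simp
  have "b x x + 2 * (- b x y / b y y) * b x y + (- b x y / b y y)\<^sup>2 * b y y \<ge> 0"
    using symmetric_square_add[OF assms(1,2), of x "- b x y / b y y" y]
      assms(3)[of "x + (- b x y / b y y) *\<^sub>R y"] by simp
  then have "b x x - (b x y)\<^sup>2 / b y y \<ge> 0"
    using p by (simp add: power2_eq_square)
  then show ?thesis using p by (simp add: field_simps)
qed

lemma hilbert_form_nonneg: "hilbert_form b \<Longrightarrow> b x x \<ge> 0"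
  using hilbert_form_pos[of b x] bounded_bilinear.zero_left[OF hilbert_form_bilinear, of b x]
  by (cases "x = 0") auto

lemma hilbert_form_eqI:
  assumes "hilbert_form b" "b x = b y"
  shows "x = y"
proof -
  interpret bounded_bilinear b by (rule hilbert_form_bilinear[OF assms(1)])
  have "b (x - y) (x - y) = 0" using assms(2) by (simp add: diff_left)
  then show ?thesis
    using hilbert_form_pos[OF assms(1), of "x - y"] by fastforce
qed

text \<open>The map \<open>x \<mapsto> b x\<close> onto the continuous dual is bijective, so by the open mapping
  theorem \<open>norm x\<close> is bounded by a multiple of the dual norm of \<open>b x\<close>.  The
  Cauchy-Schwarz inequality bounds that dual norm by a multiple of \<open>sqrt (b x x)\<close>.\<close>
lemma hilbert_form_coercive:
  fixes b :: "'a::banach \<Rightarrow> 'a \<Rightarrow> real"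
  assumes "hilbert_form b"
  obtains c where "c > 0" "\<And>x. (norm x)\<^sup>2 \<le> c * b x x"
proof -
  interpret bounded_bilinear b by (rule hilbert_form_bilinear[OF assms])
  obtain K where K: "K > 0" "\<And>x y. norm (b x y) \<le> norm x * norm y * K"
    using pos_bounded by blast
  have apply_B: "blinfun_apply (Blinfun (b x)) = b x" for x
    by (intro bounded_linear_Blinfun_apply bounded_linear_right)
  have B: "bounded_linear (\<lambda>x. Blinfun (b x))"
  proof (rule bounded_linear_intro)
    show "norm (Blinfun (b x)) \<le> norm x * K" for x
    proof (rule norm_blinfun_bound)
      show "norm (blinfun_apply (Blinfun (b x)) y) \<le> norm x * K * norm y" for y
        using K(2)[of x y] by (simp only: apply_B mult_ac)
    qed (use K(1) in simp)
  qed (auto intro!: blinfun_eqI simp: apply_B add_left scaleR_left blinfun.bilinear_simps)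
  have S: "surj (\<lambda>x. Blinfun (b x))"
  proof (rule surjI)
    fix l :: "'a \<Rightarrow>\<^sub>L real"
    have "\<exists>x. b x = blinfun_apply l"
      by (rule hilbert_form_riesz[OF assms blinfun.bounded_linear_right])
    then show "Blinfun (b (SOME x. b x = blinfun_apply l)) = l"
      by (metis (mono_tags, lifting) someI_ex blinfun_apply_inverse)
  qed
  obtain C where C: "C > 0" "\<And>l. \<exists>x. Blinfun (b x) = l \<and> norm x \<le> C * norm l"
    using open_mapping[OF B S] by blast
  have "(norm x)\<^sup>2 \<le> (C\<^sup>2 * K) * b x x" for x
  proof -
    obtain x' where x': "Blinfun (b x') = Blinfun (b x)" "norm x' \<le> C * norm (Blinfun (b x))"
      using C by blast
    then have "x' = x"
      using hilbert_form_eqI[OF assms] apply_B by metis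
    then have "norm x \<le> C * norm (Blinfun (b x))" using x' by simp
    also have "norm (Blinfun (b x)) \<le> sqrt (b x x * K)"
    proof (rule norm_blinfun_bound)
      show "0 \<le> sqrt (b x x * K)"
        using K hilbert_form_nonneg[OF assms] by simp
      show "norm (blinfun_apply (Blinfun (b x)) y) \<le> sqrt (b x x * K) * norm y" for y
      proof -
        have "(b x y)\<^sup>2 \<le> b x x * b y y"
          by (intro psd_Cauchy_Schwarz bounded_bilinear_axioms hilbert_form_sym[OF assms]
              hilbert_form_nonneg[OF assms])
        also have "\<dots> \<le> b x x * (norm y * norm y * K)"
          using K(2)[of y y] hilbert_form_nonneg[OF assms] by (intro mult_left_mono) auto
        finally have "(b x y)\<^sup>2 \<le> (b x x * K) * (norm y)\<^sup>2"
          by (simp add: power2_eq_square mult_ac)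
        then have "sqrt ((b x y)\<^sup>2) \<le> sqrt ((b x x * K) * (norm y)\<^sup>2)"
          by (rule real_sqrt_le_mono)
        then show ?thesis by (simp add: apply_B real_sqrt_mult)
      qed
    qed
    finally have "norm x \<le> C * sqrt (b x x * K)" using C(1) by simp
    then have "(norm x)\<^sup>2 \<le> (C * sqrt (b x x * K))\<^sup>2" by (intro power_mono) auto
    then show ?thesis
      using K hilbert_form_nonneg[OF assms, of x] by (simp add: power_mult_distrib mult_ac)
  qed
  then show thesis using that[of "C\<^sup>2 * K"] C K by simp
qed

text \<open>The preimage of least \<open>g\<close>-norm.  A minimising sequence in the affine subspace of preimages is
  Cauchy by the parallelogram identity and coercivity; its limit is orthogonal to the kernel, since
  otherwise moving along the kernel would decrease the norm.\<close>
lemma hilbert_form_orthogonal_lift: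
  fixes g :: "'a::banach \<Rightarrow> 'a \<Rightarrow> real" and P :: "'a \<Rightarrow> 'b::real_normed_vector"
  assumes g: "hilbert_form g" and P: "bounded_linear P" and w: "P w = u"
  obtains x where "P x = u" "\<And>k. P k = 0 \<Longrightarrow> g x k = 0"
proof -
  interpret P: bounded_linear P by fact
  interpret g: bounded_bilinear g by (rule hilbert_form_bilinear[OF g])
  note sym = hilbert_form_sym[OF g]
  note nonneg = hilbert_form_nonneg[OF g]
  define A where "A = {x. P x = u}"
  define m where "m = (INF x\<in>A. g x x)"
  have ne: "A \<noteq> {}" using w by (auto simp: A_def)
  have bdd: "bdd_below ((\<lambda>x. g x x) ` A)" using nonneg by (auto intro!: bdd_belowI)
  have m: "m \<le> g x x" if "x \<in> A" for x
    unfolding m_def using that bdd by (rule cINF_lower[rotated])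
  have "\<exists>x\<in>A. g x x < m + inverse (real (Suc n))" for n
  proof -
    have "m < m + inverse (real (Suc n))" by simp
    then show ?thesis
      unfolding m_def using cINF_less_iff[OF ne bdd] by blast
  qed
  then obtain x where x: "\<And>n. x n \<in> A" "\<And>n. g (x n) (x n) < m + inverse (real (Suc n))"
    by metis
  obtain c where c: "c > 0" "\<And>x. (norm x)\<^sup>2 \<le> c * g x x"
    using hilbert_form_coercive[OF g] by blast
  \<comment> \<open>the midpoint of two preimages is a preimage\<close>
  have par: "g (y - z) (y - z) \<le> 2 * (g y y - m) + 2 * (g z z - m)" if "y \<in> A" "z \<in> A" for y z
  proof -
    have "(1/2::real) *\<^sub>R (y + z) \<in> A"
      using that by (simp add: A_def P.scaleR P.add flip: scaleR_2)
    then have "m \<le> g ((1/2) *\<^sub>R (y + z)) ((1/2) *\<^sub>R (y + z))" by (rule m)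
    also have "\<dots> = (g y y + 2 * g y z + g z z) / 4"
      using sym[of y z] by (simp add: g.scaleR_left g.scaleR_right g.add_left g.add_right field_simps)
    finally show ?thesis
      using sym[of y z] by (simp add: g.diff_left g.diff_right)
  qed
  have "Cauchy x"
  proof (rule metric_CauchyI)
    fix e :: real assume e: "e > 0"
    define \<delta> where "\<delta> = e\<^sup>2 / (4 * c)"
    have \<delta>: "\<delta> > 0" "c * (4 * \<delta>) = e\<^sup>2"
      using e c(1) by (auto simp: \<delta>_def)
    then obtain N where N: "N > 0" "inverse (real N) < \<delta>"
      using ex_inverse_of_nat_less by blast
    have "dist (x i) (x j) < e" if "i \<ge> N" "j \<ge> N" for i j
    proof -
      have small: "g (x k) (x k) - m < \<delta>" if "k \<ge> N" for k
      proof -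
        have "inverse (real (Suc k)) \<le> inverse (real N)"
          using that N(1) by (intro le_imp_inverse_le) auto
        then show ?thesis using x(2)[of k] N(2) by linarith
      qed
      have "(dist (x i) (x j))\<^sup>2 \<le> c * g (x i - x j) (x i - x j)"
        unfolding dist_norm by (rule c)
      also have "\<dots> < c * (4 * \<delta>)"
      proof (rule mult_strict_left_mono[OF _ c(1)])
        have "g (x i - x j) (x i - x j) \<le> 2 * (g (x i) (x i) - m) + 2 * (g (x j) (x j) - m)"
          by (rule par[OF x(1) x(1)])
        also have "\<dots> < 2 * \<delta> + 2 * \<delta>"
          using small[OF that(1)] small[OF that(2)] by (intro add_strict_mono) auto
        finally show "g (x i - x j) (x i - x j) < 4 * \<delta>" by simp
      qed
      also note \<delta>(2)
      finally show ?thesis using e by (simp add: power_less_imp_less_base)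
    qed
    then show "\<exists>N. \<forall>i\<ge>N. \<forall>j\<ge>N. dist (x i) (x j) < e" by blast
  qed
  then obtain z where z: "x \<longlonglongrightarrow> z" using Cauchy_convergent convergent_def by blast
  have "(\<lambda>n. P (x n)) \<longlonglongrightarrow> P z" by (rule P.tendsto[OF z])
  then have Pz: "P z = u"
    using x(1) LIMSEQ_unique[OF _ tendsto_const] by (fastforce simp: A_def)
  have "g z z \<le> m"
  proof (rule LIMSEQ_le)
    show "(\<lambda>n. g (x n) (x n)) \<longlonglongrightarrow> g z z" by (rule g.tendsto[OF z z])
    show "(\<lambda>n. m + inverse (real (Suc n))) \<longlonglongrightarrow> m"
      using tendsto_add[OF tendsto_const LIMSEQ_inverse_real_of_nat, of m] by simp
  qed (use x(2) less_imp_le in blast)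
  have "g z k = 0" if k: "P k = 0" for k
  proof (rule ccontr)
    assume n: "g z k \<noteq> 0"
    then have "k \<noteq> 0" using g.zero_right by auto
    then have p: "g k k > 0" by (rule hilbert_form_pos[OF g])
    \<comment> \<open>the step along k that minimises the norm\<close>
    have "z + (- g z k / g k k) *\<^sub>R k \<in> A"
      using Pz k by (simp add: A_def P.add P.diff P.scaleR)
    from m[OF this] have "m \<le> g z z + 2 * (- g z k / g k k) * g z k + (- g z k / g k k)\<^sup>2 * g k k"
      using symmetric_square_add[OF g.bounded_bilinear_axioms sym] by metis
    also have "\<dots> = g z z - (g z k)\<^sup>2 / g k k"
      using p by (simp add: power2_eq_square)
    also have "\<dots> < g z z" using n p by simp
    finally show False using \<open>g z z \<le> m\<close> by simp
  qed
  then show thesis using that Pz by blast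
qed

text \<open>The form \<open>h\<close> is the one that makes \<open>P\<close> an isometry from the orthogonal complement
  of its kernel.  With \<open>s u\<close> the preimage of \<open>u\<close> orthogonal to the kernel,
  \<open>h u v = g (s u) (s v)\<close>.  It is bounded because \<open>s u\<close> has least \<open>g\<close>-norm
  among all preimages, one of which has norm controlled by that of \<open>u\<close>.  A functional
  \<open>l\<close> is represented since the vector representing \<open>l \<circ> P\<close> is orthogonal to the
  kernel.\<close>
lemma quotient_hilbert_form:
  fixes g :: "'a::banach \<Rightarrow> 'a \<Rightarrow> real" and P :: "'a \<Rightarrow> 'b::banach"
  assumes g: "hilbert_form g" and P: "bounded_linear P" and "surj P"
  obtains h where "hilbert_form h"
    "\<And>x y. (\<And>k. P k = 0 \<Longrightarrow> g x k = 0) \<Longrightarrow> h (P x) (P y) = g x y"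
proof -
  interpret P: bounded_linear P by fact
  interpret g: bounded_bilinear g by (rule hilbert_form_bilinear[OF g])
  note sym = hilbert_form_sym[OF g]
  note nonneg = hilbert_form_nonneg[OF g]
  have "\<exists>x. P x = u \<and> (\<forall>k. P k = 0 \<longrightarrow> g x k = 0)" for u
    using hilbert_form_orthogonal_lift[OF g P] \<open>surj P\<close> by (metis surj_def)
  then obtain s where s: "\<And>u. P (s u) = u" "\<And>u k. P k = 0 \<Longrightarrow> g (s u) k = 0"
    by metis
  have cong: "g (s u) x = g (s u) y" if "P x = P y" for u x y
    using s(2)[of "x - y" u] that by (simp add: P.diff g.diff_right)
  have s_unique: "x = s (P x)" if "\<And>k. P k = 0 \<Longrightarrow> g x k = 0" for x
  proof -
    have "P (x - s (P x)) = 0" by (simp add: P.diff s)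
    then have "g (x - s (P x)) (x - s (P x)) = 0"
      using that s(2) by (subst g.diff_left) simp
    then show ?thesis using hilbert_form_pos[OF g, of "x - s (P x)"] by fastforce
  qed
  have s_add: "s (u + v) = s u + s v" for u v
    using s_unique[of "s u + s v"] s by (simp add: P.add g.add_left)
  have s_scale: "s (a *\<^sub>R u) = a *\<^sub>R s u" for a u
    using s_unique[of "a *\<^sub>R s u"] s by (simp add: P.scaleR g.scaleR_left)
  have s_min: "g (s u) (s u) \<le> g x x" if "P x = u" for u x
  proof -
    have "g (s u) (x - s u) = 0" using that s by (simp add: P.diff)
    then have "g x x = g (s u) (s u) + g (x - s u) (x - s u)"
      using sym[of x "s u"] by (simp add: g.diff_left g.diff_right)
    then show ?thesis using nonneg[of "x - s u"] by simp
  qed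
  obtain C where C: "C > 0" "\<And>u. \<exists>x. P x = u \<and> norm x \<le> C * norm u"
    using open_mapping[OF P \<open>surj P\<close>] by blast
  obtain K where K: "K > 0" "\<And>x y. norm (g x y) \<le> norm x * norm y * K"
    using g.pos_bounded by blast
  have s_bound: "sqrt (g (s u) (s u)) \<le> sqrt K * C * norm u" for u
  proof -
    obtain x where x: "P x = u" "norm x \<le> C * norm u" using C by blast
    have "g (s u) (s u) \<le> norm x * norm x * K"
      using s_min[OF x(1)] K(2)[of x x] by simp
    also have "\<dots> \<le> (C * norm u) * (C * norm u) * K"
      using x K C by (intro mult_right_mono mult_mono) auto
    finally have "sqrt (g (s u) (s u)) \<le> sqrt (K * (C * norm u)\<^sup>2)"
      by (simp add: power2_eq_square mult_ac)
    then show ?thesis using C by (simp add: real_sqrt_mult mult_ac)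
  qed
  define h where "h u v = g (s u) (s v)" for u v
  have h_eq: "h u (P y) = g (s u) y" for u y
    unfolding h_def by (rule cong) (simp add: s)
  have "bounded_bilinear h"
  proof (rule bounded_bilinear.intro)
    have "norm (h u v) \<le> norm u * norm v * (K * C\<^sup>2)" for u v
    proof -
      have "(h u v)\<^sup>2 \<le> g (s u) (s u) * g (s v) (s v)"
        unfolding h_def by (intro psd_Cauchy_Schwarz g.bounded_bilinear_axioms sym nonneg)
      then have "sqrt ((h u v)\<^sup>2) \<le> sqrt (g (s u) (s u) * g (s v) (s v))"
        by (rule real_sqrt_le_mono)
      also have "\<dots> \<le> (sqrt K * C * norm u) * (sqrt K * C * norm v)"
        unfolding real_sqrt_mult using s_bound nonneg K C by (intro mult_mono) auto
      also have "\<dots> = norm u * norm v * ((sqrt K)\<^sup>2 * C\<^sup>2)"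
        by (simp only: power2_eq_square mult_ac)
      finally show ?thesis using K by simp
    qed
    then show "\<exists>K. \<forall>u v. norm (h u v) \<le> norm u * norm v * K" by blast
  qed (simp_all add: h_def s_add s_scale g.add_left g.add_right g.scaleR_left g.scaleR_right)
  moreover have "h u u > 0" if "u \<noteq> 0" for u
  proof -
    have "s u \<noteq> 0" using that s(1)[of u] P.zero by auto
    then show ?thesis unfolding h_def by (rule hilbert_form_pos[OF g])
  qed
  moreover have "\<exists>u. h u = l" if "bounded_linear l" for l
  proof -
    have "bounded_linear (\<lambda>y. l (P y))"
      using bounded_linear_compose[OF that P] .
    then obtain x where x: "g x = (\<lambda>y. l (P y))" using hilbert_form_riesz[OF g] by blast
    then have "g x k = 0" if "P k = 0" for k
      using that linear_0[OF bounded_linear.linear[OF \<open>bounded_linear l\<close>]] by simp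
    then have "s (P x) = x" using s_unique by metis
    then have "h (P x) (P y) = l (P y)" for y using x by (simp add: h_eq)
    then have "h (P x) = l" using \<open>surj P\<close> by (metis ext surj_def)
    then show ?thesis by blast
  qed
  ultimately have "hilbert_form h"
    unfolding hilbert_form_def using sym by (auto simp: h_def)
  then show thesis
    using that[of h] h_eq s_unique by metis
qed

section \<open>Fibres in coordinates\<close>

text \<open>One fibre of a bundle seen through one of its trivialisations \<open>\<tau>\<close>.  The transitions from
  all other trivialisations are bounded, so notions that quantify over every trivialisation can be
  tested in \<open>\<tau>\<close> alone.\<close>
locale fibre_chart =
  fixes E :: "('q, 'e, 'f::real_normed_vector) vbundle" and q :: 'q and \<tau> :: "'e \<Rightarrow> 'f"
  assumes triv: "\<tau> \<in> trivs_at E q"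
    and triv_bij: "\<sigma> \<in> trivs_at E q \<Longrightarrow> bij_betw \<sigma> (fib E q) UNIV"
    and transition: "\<sigma> \<in> trivs_at E q \<Longrightarrow> bounded_linear (\<lambda>x. \<tau> (inv_into (fib E q) \<sigma> x))"
    and zero_mem: "fzero E q \<in> fib E q"
    and add_mem: "\<lbrakk>u \<in> fib E q; v \<in> fib E q\<rbrakk> \<Longrightarrow> fadd E q u v \<in> fib E q"
    and scale_mem: "u \<in> fib E q \<Longrightarrow> fscale E q a u \<in> fib E q"
    and coord_zero: "\<tau> (fzero E q) = 0"
    and coord_add: "\<lbrakk>u \<in> fib E q; v \<in> fib E q\<rbrakk> \<Longrightarrow> \<tau> (fadd E q u v) = \<tau> u + \<tau> v"
    and coord_scale: "u \<in> fib E q \<Longrightarrow> \<tau> (fscale E q a u) = a *\<^sub>R \<tau> u"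
begin

abbreviation lift :: "'f \<Rightarrow> 'e" where "lift \<equiv> inv_into (fib E q) \<tau>"

lemma lift_mem: "lift x \<in> fib E q"
  using triv_bij[OF triv] by (metis UNIV_I bij_betw_imp_surj_on inv_into_into)

lemma coord_lift: "\<tau> (lift x) = x"
  using triv_bij[OF triv] by (metis UNIV_I bij_betw_inv_into_right)

lemma lift_coord: "u \<in> fib E q \<Longrightarrow> lift (\<tau> u) = u"
  using triv_bij[OF triv] by (metis bij_betw_inv_into_left)

lemma coord_eq_iff: "\<lbrakk>u \<in> fib E q; v \<in> fib E q\<rbrakk> \<Longrightarrow> \<tau> u = \<tau> v \<longleftrightarrow> u = v"
  by (metis lift_coord)

lemma other_lift_mem: "\<sigma> \<in> trivs_at E q \<Longrightarrow> inv_into (fib E q) \<sigma> x \<in> fib E q"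
  using triv_bij by (metis UNIV_I bij_betw_imp_surj_on inv_into_into)

lemma dual_iff:
  "l \<in> dual E q \<longleftrightarrow> l \<in> extensional (fib E q) \<and> bounded_linear (\<lambda>x. l (lift x))"
proof
  assume r: "l \<in> extensional (fib E q) \<and> bounded_linear (\<lambda>x. l (lift x))"
  have "bounded_linear (\<lambda>x. l (inv_into (fib E q) \<sigma> x))" if "\<sigma> \<in> trivs_at E q" for \<sigma>
    using bounded_linear_compose[of "\<lambda>x. l (lift x)", OF _ transition[OF that]] r
    by (simp add: lift_coord other_lift_mem[OF that])
  then show "l \<in> dual E q" using r by (simp add: dual_def)
qed (use triv in \<open>auto simp: dual_def\<close>)

lemma dual_eqI:
  "\<lbrakk>l \<in> dual E q; l' \<in> dual E q; \<And>x. l (lift x) = l' (lift x)\<rbrakk> \<Longrightarrow> l = l'"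
  unfolding dual_def using extensionalityI[of l "fib E q" l'] lift_coord by (metis (lifting) mem_Collect_eq)

lemma dualI:
  assumes "bounded_linear l"
  shows "(\<lambda>v\<in>fib E q. l (\<tau> v)) \<in> dual E q"
  using assms unfolding dual_iff by (simp add: lift_mem coord_lift)

text \<open>Through \<open>\<tau>\<close> the symmetric isomorphisms onto the dual fibre are exactly the forms studied
  above, which transfers the Banach space results to fibres and back.\<close>
lemma inner_iso_iff_hilbert_form:
  assumes b: "b \<in> fib E q \<rightarrow>\<^sub>E dual E q"
  shows "inner_iso E q b \<longleftrightarrow> hilbert_form (\<lambda>x y. b (lift x) (lift y))"
proof
  assume i: "inner_iso E q b"
  have "\<exists>x. (\<lambda>y. b (lift x) (lift y)) = l" if l: "bounded_linear l" for l
  proof -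
    obtain u where "u \<in> fib E q" "b u = (\<lambda>v\<in>fib E q. l (\<tau> v))"
      using i dualI[OF l] unfolding inner_iso_def bij_betw_def by (metis imageE)
    then show ?thesis
      by (intro exI[of _ "\<tau> u"]) (simp add: lift_coord lift_mem coord_lift)
  qed
  moreover have "lift x \<noteq> fzero E q" if "x \<noteq> 0" for x
    using that coord_lift[of x] coord_zero by auto
  ultimately show "hilbert_form (\<lambda>x y. b (lift x) (lift y))"
    using i triv lift_mem unfolding hilbert_form_def inner_iso_def by simp
next
  assume h: "hilbert_form (\<lambda>x y. b (lift x) (lift y))"
  let ?b = "\<lambda>x y. b (lift x) (lift y)"
  have "bounded_bilinear (\<lambda>x y. b (inv_into (fib E q) \<sigma> x) (inv_into (fib E q) \<sigma> y))"
    if "\<sigma> \<in> trivs_at E q" for \<sigma>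
  proof -
    from bounded_bilinear.comp[OF hilbert_form_bilinear[OF h] transition[OF that] transition[OF that]]
    show ?thesis by (simp add: lift_coord other_lift_mem[OF that])
  qed
  moreover have "b u v = b v u" if "u \<in> fib E q" "v \<in> fib E q" for u v
    using hilbert_form_sym[OF h, of "\<tau> u" "\<tau> v"] that by (simp add: lift_coord)
  moreover have "b u u > 0" if "u \<in> fib E q" "u \<noteq> fzero E q" for u
  proof -
    have "\<tau> u \<noteq> 0" using that coord_eq_iff zero_mem coord_zero by metis
    then show ?thesis using hilbert_form_pos[OF h, of "\<tau> u"] that by (simp add: lift_coord)
  qed
  moreover have "bij_betw b (fib E q) (dual E q)"
    unfolding bij_betw_def
  proof
    show "inj_on b (fib E q)"
    proof (rule inj_onI)
      fix u v assume uv: "u \<in> fib E q" "v \<in> fib E q" "b u = b v"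
      then have "?b (\<tau> u) = ?b (\<tau> v)" by (simp add: lift_coord)
      then have "\<tau> u = \<tau> v" by (rule hilbert_form_eqI[OF h])
      then show "u = v" using uv coord_eq_iff by simp
    qed
    show "b ` fib E q = dual E q"
    proof
      show "dual E q \<subseteq> b ` fib E q"
      proof
        fix \<alpha> assume \<alpha>: "\<alpha> \<in> dual E q"
        then obtain x where x: "?b x = (\<lambda>y. \<alpha> (lift y))"
          using hilbert_form_riesz[OF h] dual_iff by meson
        have "b (lift x) = \<alpha>"
          using b \<alpha> fun_cong[OF x] by (intro dual_eqI) (auto simp: lift_mem)
        then show "\<alpha> \<in> b ` fib E q" using lift_mem by blast
      qed
    qed (use b in auto)
  qed
  ultimately show "inner_iso E q b"
    using b unfolding inner_iso_def by simp
qed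

lemma inner_iso_hilbert_form:
  "inner_iso E q b \<Longrightarrow> hilbert_form (\<lambda>x y. b (lift x) (lift y))"
  using inner_iso_iff_hilbert_form unfolding inner_iso_def by blast

lemma inner_iso_of_hilbert_form:
  assumes "hilbert_form h"
  shows "inner_iso E q (\<lambda>u\<in>fib E q. \<lambda>v\<in>fib E q. h (\<tau> u) (\<tau> v))"
proof -
  have "bounded_linear (h x)" for x
    by (rule bounded_bilinear.bounded_linear_right[OF hilbert_form_bilinear[OF assms]])
  then have "(\<lambda>u\<in>fib E q. \<lambda>v\<in>fib E q. h (\<tau> u) (\<tau> v)) \<in> fib E q \<rightarrow>\<^sub>E dual E q"
    using dualI by auto
  then show ?thesis
    using assms by (simp add: inner_iso_iff_hilbert_form lift_mem coord_lift)
qed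

lemma inner_iso_nonneg:
  assumes "inner_iso E q b" "u \<in> fib E q"
  shows "b u u \<ge> 0"
  using hilbert_form_nonneg[OF inner_iso_hilbert_form[OF assms(1)], of "\<tau> u"] assms(2)
  by (simp add: lift_coord)

lemma inner_iso_zero: "inner_iso E q b \<Longrightarrow> b (fzero E q) (fzero E q) = 0"
  using bounded_bilinear.zero_left[OF hilbert_form_bilinear[OF inner_iso_hilbert_form], of b 0]
    lift_coord[OF zero_mem]
  by (simp add: coord_zero)

text \<open>The right side exceeds the left by \<open>s (1 - s)\<close> times the value of the form on the difference
  of \<open>u\<close> and \<open>v\<close>.\<close>
lemma inner_iso_convex:
  assumes b: "inner_iso E q b" and uv: "u \<in> fib E q" "v \<in> fib E q" and s: "0 \<le> s" "s \<le> 1"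
  shows "b (fadd E q (fscale E q (1 - s) u) (fscale E q s v))
           (fadd E q (fscale E q (1 - s) u) (fscale E q s v)) \<le> (1 - s) * b u u + s * b v v"
proof -
  let ?b = "\<lambda>x y. b (lift x) (lift y)"
  let ?x = "\<tau> u" and ?y = "\<tau> v"
  note h = inner_iso_hilbert_form[OF b]
  interpret bounded_bilinear ?b by (rule hilbert_form_bilinear[OF h])
  note sym = hilbert_form_sym[OF h, of ?y ?x]
  let ?w = "fadd E q (fscale E q (1 - s) u) (fscale E q s v)"
  have w: "?w \<in> fib E q" using uv by (simp add: add_mem scale_mem)
  have tw: "\<tau> ?w = (1 - s) *\<^sub>R ?x + s *\<^sub>R ?y" using uv by (simp add: coord_add coord_scale scale_mem)
  have "b ?w ?w = ?b ((1 - s) *\<^sub>R ?x + s *\<^sub>R ?y) ((1 - s) *\<^sub>R ?x + s *\<^sub>R ?y)"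
    using lift_coord[OF w] by (simp add: tw)
  also have "\<dots> = (1 - s) * ?b ?x ?x + s * ?b ?y ?y - s * (1 - s) * ?b (?x - ?y) (?x - ?y)"
    unfolding add_left add_right diff_left diff_right scaleR_left scaleR_right sym
    by (simp add: algebra_simps)
  also have "\<dots> \<le> (1 - s) * ?b ?x ?x + s * ?b ?y ?y"
    using s hilbert_form_nonneg[OF h, of "?x - ?y"] by simp
  finally show ?thesis using uv by (simp add: lift_coord)
qed

lemma riesz_mem: "\<lbrakk>inner_iso E q b; l \<in> dual E q\<rbrakk> \<Longrightarrow> inv_into (fib E q) b l \<in> fib E q"
  unfolding inner_iso_def bij_betw_def by (metis inv_into_into)

lemma riesz_eq: "\<lbrakk>inner_iso E q b; l \<in> dual E q\<rbrakk> \<Longrightarrow> b (inv_into (fib E q) b l) = l"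
  unfolding inner_iso_def by (metis bij_betw_inv_into_right)

lemma riesz_eqI: "\<lbrakk>inner_iso E q b; u \<in> fib E q; b u = l\<rbrakk> \<Longrightarrow> inv_into (fib E q) b l = u"
  unfolding inner_iso_def by (metis bij_betw_inv_into_left)

text \<open>Onsager's principle in one fibre.  With \<open>b a = l\<close>, completing the square gives
  \<open>l w + b w w / 2 = b (w + a) (w + a) / 2 - b a a / 2\<close>, whose only minimiser is
  \<open>- a\<close>.\<close>
lemma is_arg_min_linear_plus_half_form:
  assumes b: "inner_iso E q b" and l: "l \<in> dual E q"
  shows "is_arg_min (\<lambda>w. l w + 1/2 * b w w) (\<lambda>w. w \<in> fib E q) v \<longleftrightarrow>
         v = fscale E q (-1) (inv_into (fib E q) b l)"
proof -
  let ?b = "\<lambda>x y. b (lift x) (lift y)" and ?R = "\<lambda>w. l w + 1/2 * b w w"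
  define a where "a = inv_into (fib E q) b l"
  define v0 where "v0 = fscale E q (-1) a"
  note h = inner_iso_hilbert_form[OF b]
  interpret bounded_bilinear ?b by (rule hilbert_form_bilinear[OF h])
  have a: "a \<in> fib E q" "b a = l"
    using b l riesz_mem riesz_eq by (auto simp: a_def)
  have v0: "v0 \<in> fib E q" "\<tau> v0 = - \<tau> a"
    using a by (auto simp: v0_def scale_mem coord_scale)
  have square: "?R w = 1/2 * ?b (\<tau> w - \<tau> v0) (\<tau> w - \<tau> v0) - 1/2 * b a a" if w: "w \<in> fib E q" for w
  proof -
    have "?b (\<tau> w - \<tau> v0) (\<tau> w - \<tau> v0) = ?b (\<tau> w) (\<tau> w) + 2 * ?b (\<tau> a) (\<tau> w) + ?b (\<tau> a) (\<tau> a)"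
      using hilbert_form_sym[OF h, of "\<tau> w" "\<tau> a"]
      unfolding v0 by (simp add: add_left add_right)
    then show ?thesis using w a by (simp add: lift_coord field_simps)
  qed
  have Rv0: "?R v0 = - (1/2 * b a a)" using square[OF v0(1)] by (simp add: zero_left)
  have "is_arg_min ?R (\<lambda>w. w \<in> fib E q) v \<longleftrightarrow> v = v0"
  proof
    assume "is_arg_min ?R (\<lambda>w. w \<in> fib E q) v"
    then have v: "v \<in> fib E q" "?R v \<le> ?R v0"
      using v0 by (auto simp: is_arg_min_linorder)
    then have "\<not> ?b (\<tau> v - \<tau> v0) (\<tau> v - \<tau> v0) > 0"
      using square[OF v(1)] Rv0 by linarith
    then have "\<tau> v = \<tau> v0" using hilbert_form_pos[OF h, of "\<tau> v - \<tau> v0"] by fastforce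
    then show "v = v0" using v v0 coord_eq_iff by blast
  next
    assume "v = v0"
    moreover have "?R v0 \<le> ?R w" if "w \<in> fib E q" for w
      using square[OF that] Rv0 hilbert_form_nonneg[OF h, of "\<tau> w - \<tau> v0"] by linarith
    ultimately show "is_arg_min ?R (\<lambda>w. w \<in> fib E q) v"
      using v0 unfolding is_arg_min_linorder by blast
  qed
  then show ?thesis by (simp add: v0_def a_def)
qed

end

section \<open>Pushing an inner product forward along a surjection\<close>

locale fibre_map =
  src: fibre_chart E q \<tau> + tgt: fibre_chart E' q \<sigma>
  for E :: "('q, 'e, 'f::banach) vbundle" and E' :: "('q, 'd, 'g::banach) vbundle"
    and q :: 'q and \<tau> :: "'e \<Rightarrow> 'f" and \<sigma> :: "'d \<Rightarrow> 'g" +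
  fixes P :: "'q \<Rightarrow> 'e \<Rightarrow> 'd"
  assumes map_surj: "P q ` fib E q = fib E' q"
    and map_bounded: "bounded_linear (\<lambda>x. \<sigma> (P q (src.lift x)))"
begin

abbreviation coord_map :: "'f \<Rightarrow> 'g" where "coord_map x \<equiv> \<sigma> (P q (src.lift x))"

lemma map_mem: "u \<in> fib E q \<Longrightarrow> P q u \<in> fib E' q"
  using map_surj by blast

lemma lift_coord_map: "tgt.lift (coord_map x) = P q (src.lift x)"
  by (simp add: tgt.lift_coord map_mem src.lift_mem)

lemma surj_coord_map: "surj coord_map"
proof -
  have "\<exists>x. y = coord_map x" for y
    using map_surj tgt.lift_mem[of y] by (metis (no_types, lifting) imageE src.lift_coord tgt.coord_lift)
  then show ?thesis by (simp add: surj_def)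
qed

lemma transpose_dual: "\<omega> \<in> dual E' q \<Longrightarrow> transpose_at E P q \<omega> \<in> dual E q"
  using bounded_linear_compose[of "\<lambda>y. \<omega> (tgt.lift y)", OF _ map_bounded]
  unfolding src.dual_iff tgt.dual_iff transpose_at_def
  by (simp add: src.lift_mem lift_coord_map)

text \<open>The quotient form has the required inverse: the vector \<open>a\<close> with
  \<open>g a = P\<^sup>T \<omega>\<close> is orthogonal to the kernel of \<open>P\<close>, hence
  \<open>h (P a) (P w) = g a w = \<omega> (P w)\<close>, so \<open>P a\<close> represents \<open>\<omega>\<close>.\<close>
lemma push_forward_form_exists:
  assumes g: "inner_iso E q g"
  obtains h where "inner_iso E' q h"
    "\<And>\<omega>\<^sub>1 \<omega>\<^sub>2. \<lbrakk>\<omega>\<^sub>1 \<in> dual E' q; \<omega>\<^sub>2 \<in> dual E' q\<rbrakk> \<Longrightarrow>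
       inverse_form E' q h \<omega>\<^sub>1 \<omega>\<^sub>2 =
       inverse_form E q g (transpose_at E P q \<omega>\<^sub>1) (transpose_at E P q \<omega>\<^sub>2)"
proof -
  obtain k where k: "hilbert_form k"
    "\<And>x y. (\<And>z. coord_map z = 0 \<Longrightarrow> g (src.lift x) (src.lift z) = 0) \<Longrightarrow>
       k (coord_map x) (coord_map y) = g (src.lift x) (src.lift y)"
    using quotient_hilbert_form[OF src.inner_iso_hilbert_form[OF g] map_bounded surj_coord_map]
    by blast
  define h where "h = (\<lambda>u\<in>fib E' q. \<lambda>v\<in>fib E' q. k (\<sigma> u) (\<sigma> v))"
  have h: "inner_iso E' q h"
    unfolding h_def by (rule tgt.inner_iso_of_hilbert_form[OF k(1)])
  let ?a = "\<lambda>\<omega>. inv_into (fib E q) g (transpose_at E P q \<omega>)"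
  have a: "?a \<omega> \<in> fib E q" "g (?a \<omega>) = transpose_at E P q \<omega>" if "\<omega> \<in> dual E' q" for \<omega>
    using that g transpose_dual src.riesz_mem src.riesz_eq by auto
  \<comment> \<open>the representing vectors are orthogonal to the kernel, so the quotient form applies to them\<close>
  have form: "h (P q (?a \<omega>)) (P q w) = g (?a \<omega>) w" if \<omega>: "\<omega> \<in> dual E' q" and w: "w \<in> fib E q" for \<omega> w
  proof -
    have "g (?a \<omega>) (src.lift z) = 0" if "coord_map z = 0" for z
    proof -
      have "g (?a \<omega>) (src.lift z) = \<omega> (tgt.lift (coord_map z))"
        unfolding a(2)[OF \<omega>] by (simp add: transpose_at_def src.lift_mem lift_coord_map)
      also have "\<dots> = 0"
        using \<omega> that linear_0[OF bounded_linear.linear, of "\<lambda>y. \<omega> (tgt.lift y)"]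
        unfolding tgt.dual_iff by simp
      finally show ?thesis .
    qed
    then show ?thesis
      using k(2)[of "\<tau> (?a \<omega>)" "\<tau> w"] a \<omega> w by (simp add: h_def src.lift_coord map_mem)
  qed
  have inv: "inv_into (fib E' q) h \<omega> = P q (?a \<omega>)" if \<omega>: "\<omega> \<in> dual E' q" for \<omega>
  proof (rule tgt.riesz_eqI[OF h])
    show "P q (?a \<omega>) \<in> fib E' q" using a \<omega> map_mem by blast
    have "h (P q (?a \<omega>)) \<in> dual E' q"
      using h \<open>P q (?a \<omega>) \<in> fib E' q\<close> unfolding inner_iso_def by auto
    moreover have "h (P q (?a \<omega>)) (tgt.lift y) = \<omega> (tgt.lift y)" for y
    proof -
      obtain w where w: "w \<in> fib E q" "tgt.lift y = P q w"
        using map_surj tgt.lift_mem by (metis imageE)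
      then show ?thesis using form[OF \<omega> w(1)] a[OF \<omega>] by (simp add: transpose_at_def)
    qed
    ultimately show "h (P q (?a \<omega>)) = \<omega>"
      using \<omega> tgt.dual_eqI by blast
  qed
  show thesis
    using that[OF h] form a by (simp add: inverse_form_def inv)
qed

text \<open>The inverse form determines the inverse map.  Both sides are vectors on which every
  functional \<open>\<omega>'\<close> takes the value \<open>h\<^sup>-\<^sup>1(\<omega>', \<omega>)\<close>, and the functionals
  \<open>h u\<close> separate points.\<close>
lemma push_forward_riesz:
  assumes g: "inner_iso E q g" and h: "inner_iso E' q h"
    and inverse: "\<And>\<omega>\<^sub>1 \<omega>\<^sub>2. \<lbrakk>\<omega>\<^sub>1 \<in> dual E' q; \<omega>\<^sub>2 \<in> dual E' q\<rbrakk> \<Longrightarrow>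
       inverse_form E' q h \<omega>\<^sub>1 \<omega>\<^sub>2 =
       inverse_form E q g (transpose_at E P q \<omega>\<^sub>1) (transpose_at E P q \<omega>\<^sub>2)"
    and \<omega>: "\<omega> \<in> dual E' q"
  shows "inv_into (fib E' q) h \<omega> = P q (inv_into (fib E q) g (transpose_at E P q \<omega>))"
proof -
  let ?v = "inv_into (fib E' q) h \<omega>" and ?a = "inv_into (fib E q) g (transpose_at E P q \<omega>)"
  have v: "?v \<in> fib E' q" and a: "?a \<in> fib E q"
    using h g \<omega> tgt.riesz_mem src.riesz_mem transpose_dual by auto
  have same: "\<omega>' ?v = \<omega>' (P q ?a)" if "\<omega>' \<in> dual E' q" for \<omega>'
    using inverse[OF that \<omega>] tgt.riesz_eq[OF h that] src.riesz_eq[OF g transpose_dual[OF that]] a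
    by (simp add: inverse_form_def transpose_at_def)
  have dual: "h u \<in> dual E' q" if "u \<in> fib E' q" for u
    using h that unfolding inner_iso_def by auto
  have "h ?v (tgt.lift y) = h (P q ?a) (tgt.lift y)" for y
    using same[OF dual[OF tgt.lift_mem]] h v map_mem[OF a] tgt.lift_mem
    unfolding inner_iso_def by metis
  then have "h ?v = h (P q ?a)"
    using dual v map_mem[OF a] tgt.dual_eqI by blast
  then show ?thesis
    using h v map_mem[OF a] unfolding inner_iso_def bij_betw_def inj_on_def by blast
qed

lemma push_forward_form_unique:
  assumes "inner_iso E q g" "inner_iso E' q h" "inner_iso E' q h'"
    and "\<And>\<omega>\<^sub>1 \<omega>\<^sub>2. \<lbrakk>\<omega>\<^sub>1 \<in> dual E' q; \<omega>\<^sub>2 \<in> dual E' q\<rbrakk> \<Longrightarrow>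
       inverse_form E' q h \<omega>\<^sub>1 \<omega>\<^sub>2 =
       inverse_form E q g (transpose_at E P q \<omega>\<^sub>1) (transpose_at E P q \<omega>\<^sub>2)"
    and "\<And>\<omega>\<^sub>1 \<omega>\<^sub>2. \<lbrakk>\<omega>\<^sub>1 \<in> dual E' q; \<omega>\<^sub>2 \<in> dual E' q\<rbrakk> \<Longrightarrow>
       inverse_form E' q h' \<omega>\<^sub>1 \<omega>\<^sub>2 =
       inverse_form E q g (transpose_at E P q \<omega>\<^sub>1) (transpose_at E P q \<omega>\<^sub>2)"
  shows "h = h'"
proof -
  have eq: "inv_into (fib E' q) h \<omega> = inv_into (fib E' q) h' \<omega>" if "\<omega> \<in> dual E' q" for \<omega>
    using push_forward_riesz[OF assms(1,2,4) that] push_forward_riesz[OF assms(1,3,5) that] by simp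
  have ext: "h \<in> extensional (fib E' q)" "h' \<in> extensional (fib E' q)"
    using assms(2,3) unfolding inner_iso_def PiE_def by auto
  have "h u = h' u" if u: "u \<in> fib E' q" for u
  proof -
    have "h u \<in> dual E' q" using assms(2) u unfolding inner_iso_def by auto
    then show ?thesis
      using tgt.riesz_eqI[OF assms(2) u refl] tgt.riesz_eq[OF assms(3)] eq by metis
  qed
  then show ?thesis using ext extensionalityI by blast
qed

end

section \<open>Vector bundles and their homomorphisms in coordinates\<close>

lemma vector_bundle_imp_identity_hom:
  "vector_bundle X E \<Longrightarrow> bundle_hom X E E (\<lambda>q w. w)"
  unfolding vector_bundle_def bundle_hom_def by auto

text \<open>Joint continuity, restricted to a single base point, makes the linear local representative
  continuous and hence bounded.\<close>
lemma bundle_hom_coord_bounded: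
  assumes E: "vector_bundle X E" and E': "vector_bundle X E'" and P: "bundle_hom X E E' P"
    and q: "q \<in> topspace X" and \<tau>: "\<tau> \<in> trivs_at E q" and \<sigma>: "\<sigma> \<in> trivs_at E' q"
  shows "bounded_linear (\<lambda>x. \<sigma> (P q (inv_into (fib E q) \<tau> x)))" (is "bounded_linear ?f")
proof (rule bounded_linear_if_continuous_at_0)
  let ?l = "inv_into (fib E q) \<tau>"
  have bij: "bij_betw \<tau> (fib E q) UNIV"
    and lin: "\<And>u v. \<lbrakk>u \<in> fib E q; v \<in> fib E q\<rbrakk> \<Longrightarrow> \<tau> (fadd E q u v) = \<tau> u + \<tau> v"
      "\<And>a u. u \<in> fib E q \<Longrightarrow> \<tau> (fscale E q a u) = a *\<^sub>R \<tau> u"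
    and mem: "\<And>u v. \<lbrakk>u \<in> fib E q; v \<in> fib E q\<rbrakk> \<Longrightarrow> fadd E q u v \<in> fib E q"
      "\<And>a u. u \<in> fib E q \<Longrightarrow> fscale E q a u \<in> fib E q"
    using E q \<tau> unfolding vector_bundle_def by simp_all
  have lin': "\<And>u v. \<lbrakk>u \<in> fib E' q; v \<in> fib E' q\<rbrakk> \<Longrightarrow> \<sigma> (fadd E' q u v) = \<sigma> u + \<sigma> v"
      "\<And>a u. u \<in> fib E' q \<Longrightarrow> \<sigma> (fscale E' q a u) = a *\<^sub>R \<sigma> u"
    using E' q \<sigma> unfolding vector_bundle_def by simp_all
  have Pq: "\<And>u. u \<in> fib E q \<Longrightarrow> P q u \<in> fib E' q"
      "\<And>u v. \<lbrakk>u \<in> fib E q; v \<in> fib E q\<rbrakk> \<Longrightarrow> P q (fadd E q u v) = fadd E' q (P q u) (P q v)"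
      "\<And>a u. u \<in> fib E q \<Longrightarrow> P q (fscale E q a u) = fscale E' q a (P q u)"
    using P q unfolding bundle_hom_def by auto
  have l: "?l x \<in> fib E q" "\<tau> (?l x) = x" for x
    using bij by (metis UNIV_I bij_betw_imp_surj_on inv_into_into, metis UNIV_I bij_betw_inv_into_right)
  have l_left: "?l (\<tau> u) = u" if "u \<in> fib E q" for u
    using bij that by (metis bij_betw_inv_into_left)
  have "?l (x + y) = fadd E q (?l x) (?l y)" for x y
    using l_left[OF mem(1)[OF l(1) l(1)], of x y] by (simp add: lin l)
  moreover have "?l (a *\<^sub>R x) = fscale E q a (?l x)" for a x
    using l_left[OF mem(2)[OF l(1)], of a x] by (simp add: lin l)
  ultimately show "linear ?f"
    by (intro linearI) (simp_all add: l Pq lin')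
  obtain U T where UT: "(U, T) \<in> trivs E" "q \<in> U" "\<tau> = T q"
    using \<tau> unfolding trivs_at_def by auto
  obtain V S where VS: "(V, S) \<in> trivs E'" "q \<in> V" "\<sigma> = S q"
    using \<sigma> unfolding trivs_at_def by auto
  let ?X = "subtopology X (U \<inter> V)"
  have c: "continuous_map (prod_topology ?X euclidean) euclidean
      (\<lambda>(q, x). S q (P q (inv_into (fib E q) (T q) x)))"
    using P UT(1) VS(1) unfolding bundle_hom_def bundle_continuous_def by fastforce
  have "continuous_map euclidean (prod_topology ?X euclidean) (\<lambda>x. (q, x))"
    using q UT VS by (intro continuous_map_pairedI) auto
  from continuous_map_compose[OF this c] have "continuous_on UNIV ?f"
    by (simp add: o_def UT VS)
  then show "isCont ?f 0" by (simp add: continuous_on_eq_continuous_at)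
qed

text \<open>The transition maps are the local representatives of the identity homomorphism.\<close>
lemma vector_bundle_fibre_chart:
  assumes "vector_bundle X E" "q \<in> topspace X" "\<tau> \<in> trivs_at E q"
  shows "fibre_chart E q \<tau>"
proof (rule fibre_chart.intro)
  show "bounded_linear (\<lambda>x. \<tau> (inv_into (fib E q) \<sigma> x))" if "\<sigma> \<in> trivs_at E q" for \<sigma>
    using bundle_hom_coord_bounded[OF assms(1,1) vector_bundle_imp_identity_hom[OF assms(1)]
        assms(2) that assms(3)] .
qed (use assms in \<open>simp_all add: vector_bundle_def\<close>)

lemma vector_bundle_obtain_chart:
  assumes "vector_bundle X E" "q \<in> topspace X"
  obtains \<tau> where "\<tau> \<in> trivs_at E q" "fibre_chart E q \<tau>"
proof -
  have "trivs_at E q \<noteq> {}" using assms unfolding vector_bundle_def by blast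
  then show thesis using that vector_bundle_fibre_chart[OF assms] by blast
qed

section \<open>The tangent bundle of a Banach manifold\<close>

text \<open>The cocycle of the tangent bundle: the change of coordinates of tangent vectors at \<open>q\<close>
  from the chart \<open>c\<close> to the chart \<open>d\<close>.\<close>
definition transition_derivative ::
    "('q, 'b::real_normed_vector) chart \<Rightarrow> ('q, 'b) chart \<Rightarrow> 'q \<Rightarrow> 'b \<Rightarrow> 'b" where
  "transition_derivative c d q =
     frechet_derivative (snd d \<circ> inv_into (fst c) (snd c)) (at (snd c q))"

lemma charts_at_iff: "c \<in> charts_at M q \<longleftrightarrow> c \<in> charts M \<and> q \<in> fst c"
  by (simp add: charts_at_def)

lemma tangent_space_iff:
  "v \<in> tangent_space M q \<longleftrightarrow> v \<in> extensional (charts_at M q) \<and>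
     (\<forall>c\<in>charts_at M q. \<forall>d\<in>charts_at M q. v d = transition_derivative c d q (v c))"
  unfolding tangent_space_def transition_derivative_def by fastforce

lemma
  assumes "banach_manifold M" "c \<in> charts M"
  shows chart_inj: "inj_on (snd c) (fst c)"
    and chart_openin: "openin (mtop M) (fst c)"
    and chart_open_map: "openin (mtop M) W \<Longrightarrow> open (snd c ` (fst c \<inter> W))"
    and chart_continuous: "continuous_map (subtopology (mtop M) (fst c)) euclidean (snd c)"
proof -
  obtain U \<phi> where c: "c = (U, \<phi>)" by fastforce
  have U: "openin (mtop M) U" "open (\<phi> ` U)"
    and hom: "homeomorphic_map (subtopology (mtop M) U) (top_of_set (\<phi> ` U)) \<phi>"
    using assms unfolding banach_manifold_def c by auto
  show "openin (mtop M) (fst c)" using U(1) by (simp add: c)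
  have top: "topspace (subtopology (mtop M) U) = U"
    using openin_subset[OF U(1)] by auto
  show "inj_on (snd c) (fst c)"
    using hom top by (simp add: c homeomorphic_eq_everything_map)
  show "continuous_map (subtopology (mtop M) (fst c)) euclidean (snd c)"
    using homeomorphic_imp_continuous_map[OF hom] continuous_map_into_fulltopology by (auto simp: c)
  show "open (snd c ` (fst c \<inter> W))" if "openin (mtop M) W"
  proof -
    have "openin (subtopology (mtop M) U) (U \<inter> W)"
      using that by (simp add: openin_subtopology_Int2)
    then have "openin (top_of_set (\<phi> ` U)) (\<phi> ` (U \<inter> W))"
      using homeomorphic_imp_open_map[OF hom] unfolding open_map_def by blast
    then show ?thesis using U(2) openin_open_trans by (auto simp: c)
  qed
qed

lemma transition_C1:
  assumes M: "banach_manifold M" and c: "c \<in> charts M" and d: "d \<in> charts M"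
  obtains f' where "continuous_on (snd c ` (fst c \<inter> fst d)) f'"
    "\<And>q. q \<in> fst c \<inter> fst d \<Longrightarrow>
       ((snd d \<circ> inv_into (fst c) (snd c)) has_derivative blinfun_apply (f' (snd c q))) (at (snd c q))"
proof -
  have "C1_on (snd c ` (fst c \<inter> fst d)) (snd d \<circ> inv_into (fst c) (snd c))"
    using M c d unfolding banach_manifold_def by fastforce
  then show thesis using that unfolding C1_on_def by blast
qed

lemma transition_has_derivative:
  assumes M: "banach_manifold M" and c: "c \<in> charts_at M q" and d: "d \<in> charts_at M q"
  shows "((snd d \<circ> inv_into (fst c) (snd c)) has_derivative transition_derivative c d q) (at (snd c q))"
proof -
  obtain f' where "((snd d \<circ> inv_into (fst c) (snd c)) has_derivative blinfun_apply f') (at (snd c q))"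
    using transition_C1[OF M, of c d] c d by (metis IntI charts_at_iff)
  then show ?thesis
    unfolding transition_derivative_def using frechet_derivative_at by metis
qed

lemma transition_derivative_linear:
  "\<lbrakk>banach_manifold M; c \<in> charts_at M q; d \<in> charts_at M q\<rbrakk> \<Longrightarrow> linear (transition_derivative c d q)"
  by (rule has_derivative_linear[OF transition_has_derivative])

text \<open>The cocycle identity, from the chain rule: near \<open>q\<close> the transition from \<open>c\<close> to
  \<open>e\<close> factors through \<open>d\<close>.\<close>
lemma transition_derivative_compose:
  assumes M: "banach_manifold M"
    and c: "c \<in> charts_at M q" and d: "d \<in> charts_at M q" and e: "e \<in> charts_at M q"
  shows "transition_derivative d e q (transition_derivative c d q x) = transition_derivative c e q x"
proof -
  let ?ic = "inv_into (fst c) (snd c)" and ?id = "inv_into (fst d) (snd d)"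
  note ch = c[unfolded charts_at_iff] d[unfolded charts_at_iff] e[unfolded charts_at_iff]
  have inv: "?ic (snd c p) = p" if "p \<in> fst c" for p
    using chart_inj[OF M] ch that by simp
  have invd: "?id (snd d p) = p" if "p \<in> fst d" for p
    using chart_inj[OF M] ch that by simp
  have "((snd e \<circ> ?id) has_derivative transition_derivative d e q) (at ((snd d \<circ> ?ic) (snd c q)))"
    using transition_has_derivative[OF M d e] inv ch by simp
  then have "((snd e \<circ> ?id) \<circ> (snd d \<circ> ?ic) has_derivative
      transition_derivative d e q \<circ> transition_derivative c d q) (at (snd c q))"
    by (rule diff_chain_at[OF transition_has_derivative[OF M c d]])
  then have "((snd e \<circ> ?ic) has_derivative
      transition_derivative d e q \<circ> transition_derivative c d q) (at (snd c q))"
  proof (rule has_derivative_transform_within_open)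
    show "open (snd c ` (fst c \<inter> fst d))"
      using chart_open_map[OF M] chart_openin[OF M] ch by blast
    show "snd c q \<in> snd c ` (fst c \<inter> fst d)" using ch by blast
  qed (auto simp: inv invd)
  then show ?thesis
    using has_derivative_unique[OF transition_has_derivative[OF M c e]] by (metis comp_apply)
qed

lemma transition_derivative_same:
  assumes M: "banach_manifold M" and c: "c \<in> charts_at M q"
  shows "transition_derivative c c q x = x"
proof -
  let ?ic = "inv_into (fst c) (snd c)"
  note ch = c[unfolded charts_at_iff]
  have "((\<lambda>x. x) has_derivative (\<lambda>x. x)) (at (snd c q))" by (rule has_derivative_ident)
  then have "((snd c \<circ> ?ic) has_derivative (\<lambda>x. x)) (at (snd c q))"
  proof (rule has_derivative_transform_within_open)
    show "open (snd c ` (fst c \<inter> fst c))"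
      using chart_open_map[OF M] chart_openin[OF M] ch by blast
    show "snd c q \<in> snd c ` (fst c \<inter> fst c)" using ch by blast
  qed (auto simp: f_inv_into_f)
  then show ?thesis
    using has_derivative_unique[OF transition_has_derivative[OF M c c]] by metis
qed

lemma tangent_vector_of_coord:
  assumes M: "banach_manifold M" and c: "c \<in> charts_at M q"
  shows "(\<lambda>d\<in>charts_at M q. transition_derivative c d q x) \<in> tangent_space M q"
  using assms by (simp add: tangent_space_iff transition_derivative_compose)

text \<open>A tangent vector is determined by its coordinates in one chart, and the cocycle identity makes
  arbitrary coordinates in one chart extend to all others.\<close>
lemma tangent_coord_bij:
  assumes M: "banach_manifold M" and c: "c \<in> charts_at M q"
  shows "bij_betw (\<lambda>v. v c) (tangent_space M q) UNIV"
proof (rule bij_betw_byWitness)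
  let ?w = "\<lambda>x. \<lambda>d\<in>charts_at M q. transition_derivative c d q x"
  show "\<forall>v\<in>tangent_space M q. ?w (v c) = v"
  proof
    fix v assume v: "v \<in> tangent_space M q"
    show "?w (v c) = v"
    proof (rule extensionalityI[of _ "charts_at M q"])
      show "v \<in> extensional (charts_at M q)" using v by (simp add: tangent_space_iff)
      show "?w (v c) d = v d" if d: "d \<in> charts_at M q" for d
        using v c d unfolding tangent_space_iff by (metis restrict_apply')
    qed simp
  qed
  show "\<forall>x\<in>UNIV. ?w x c = x" using transition_derivative_same[OF assms] c by simp
  show "?w ` UNIV \<subseteq> tangent_space M q" using tangent_vector_of_coord[OF assms] by blast
qed simp

lemma inv_into_tangent_coord:
  assumes M: "banach_manifold M" and c: "c \<in> charts_at M q"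
  shows "inv_into (tangent_space M q) (\<lambda>v. v c) x = (\<lambda>d\<in>charts_at M q. transition_derivative c d q x)"
proof (rule inv_into_f_eq)
  show "inj_on (\<lambda>v. v c) (tangent_space M q)"
    using tangent_coord_bij[OF assms] by (rule bij_betw_imp_inj_on)
qed (use assms in \<open>simp_all add: tangent_vector_of_coord transition_derivative_same\<close>)

lemma fib_tangent_bundle [simp]: "fib (tangent_bundle M) = tangent_space M"
  by (simp add: tangent_bundle_def)

lemma trivs_tangent_bundle:
  "trivs (tangent_bundle M) = (\<lambda>c. (fst c, \<lambda>q v. v c)) ` charts M"
  by (simp add: tangent_bundle_def case_prod_beta)

lemma trivs_at_tangent_bundle:
  fixes M :: "('a, 'b::real_normed_vector) manifold"
  shows "trivs_at (tangent_bundle M) q = (\<lambda>c v. v c) ` charts_at M q"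
proof (intro equalityI subsetI)
  fix \<tau> :: "(('a, 'b) chart \<Rightarrow> 'b) \<Rightarrow> 'b"
  assume "\<tau> \<in> (\<lambda>c v. v c) ` charts_at M q"
  then obtain c where c: "c \<in> charts M" "q \<in> fst c" "\<tau> = (\<lambda>v. v c)"
    by (auto simp: charts_at_iff)
  then have "(fst c, \<lambda>q v. v c) \<in> trivs (tangent_bundle M)"
    by (auto simp: trivs_tangent_bundle)
  then show "\<tau> \<in> trivs_at (tangent_bundle M) q"
    unfolding trivs_at_def c(3) using c(2) by force
qed (auto simp: trivs_at_def trivs_tangent_bundle charts_at_iff)

lemma
  assumes M: "banach_manifold M"
  shows tangent_space_zero: "(\<lambda>c\<in>charts_at M q. 0) \<in> tangent_space M q"
    and tangent_space_add: "\<lbrakk>u \<in> tangent_space M q; v \<in> tangent_space M q\<rbrakk> \<Longrightarrow>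
          (\<lambda>c\<in>charts_at M q. u c + v c) \<in> tangent_space M q"
    and tangent_space_scale: "u \<in> tangent_space M q \<Longrightarrow>
          (\<lambda>c\<in>charts_at M q. a *\<^sub>R u c) \<in> tangent_space M q"
proof -
  note lin = transition_derivative_linear[OF M]
  have tr: "w d = transition_derivative c d q (w c)"
    if "w \<in> tangent_space M q" "c \<in> charts_at M q" "d \<in> charts_at M q" for w c d
    using that unfolding tangent_space_iff by blast
  show "(\<lambda>c\<in>charts_at M q. 0) \<in> tangent_space M q"
    using linear_0[OF lin] by (simp add: tangent_space_iff)
  show "(\<lambda>c\<in>charts_at M q. u c + v c) \<in> tangent_space M q"
    if "u \<in> tangent_space M q" "v \<in> tangent_space M q"
    unfolding tangent_space_iff
    by (auto simp: linear_add[OF lin] tr[OF that(1), symmetric] tr[OF that(2), symmetric])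
  show "(\<lambda>c\<in>charts_at M q. a *\<^sub>R u c) \<in> tangent_space M q"
    if "u \<in> tangent_space M q"
    unfolding tangent_space_iff by (auto simp: linear_scale[OF lin] tr[OF that, symmetric])
qed

text \<open>In coordinates the identity of the tangent bundle is \<open>(q, x) \<mapsto> D(q) x\<close> with
  \<open>D\<close> the derivative of the chart transition.  Class \<open>C\<^sup>1\<close> means continuity of
  \<open>D\<close> in the operator norm, which gives joint continuity.\<close>
lemma tangent_bundle_vector_bundle:
  assumes M: "banach_manifold M"
  shows "vector_bundle (mtop M) (tangent_bundle M)"
  unfolding vector_bundle_def
proof (intro conjI)
  let ?T = "tangent_bundle M"
  show "\<forall>q\<in>points M. trivs_at ?T q \<noteq> {}"
    using M unfolding trivs_at_tangent_bundle banach_manifold_def by simp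
  show "\<forall>(U, \<tau>)\<in>trivs ?T. openin (mtop M) U"
    using chart_openin[OF M] by (auto simp: trivs_tangent_bundle)
  show "\<forall>q\<in>points M. fzero ?T q \<in> fib ?T q \<and>
        (\<forall>u\<in>fib ?T q. \<forall>v\<in>fib ?T q. fadd ?T q u v \<in> fib ?T q) \<and>
        (\<forall>a. \<forall>u\<in>fib ?T q. fscale ?T q a u \<in> fib ?T q)"
    using tangent_space_zero[OF M] tangent_space_add[OF M] tangent_space_scale[OF M]
    by (simp add: tangent_bundle_def)
  show "\<forall>q\<in>points M. \<forall>\<tau>\<in>trivs_at ?T q.
        bij_betw \<tau> (fib ?T q) UNIV \<and> \<tau> (fzero ?T q) = 0 \<and>
        (\<forall>u\<in>fib ?T q. \<forall>v\<in>fib ?T q. \<tau> (fadd ?T q u v) = \<tau> u + \<tau> v) \<and>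
        (\<forall>a. \<forall>u\<in>fib ?T q. \<tau> (fscale ?T q a u) = a *\<^sub>R \<tau> u)"
    using tangent_coord_bij[OF M]
    by (auto simp: trivs_at_tangent_bundle) (auto simp: tangent_bundle_def)
  show "bundle_continuous (mtop M) ?T ?T (\<lambda>q w. w)"
    unfolding bundle_continuous_def
  proof clarify
    fix U V \<tau> \<sigma> assume "(U, \<tau>) \<in> trivs ?T" "(V, \<sigma>) \<in> trivs ?T"
    then obtain c d where c: "c \<in> charts M" "U = fst c" "\<tau> = (\<lambda>q v. v c)"
      and d: "d \<in> charts M" "V = fst d" "\<sigma> = (\<lambda>q v. v d)"
      by (auto simp: trivs_tangent_bundle)
    let ?X = "subtopology (mtop M) (U \<inter> V)"
    have c_at: "c \<in> charts_at M q" and d_at: "d \<in> charts_at M q" if "q \<in> U \<inter> V" for q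
      using c d that by (auto simp: charts_at_iff)
    obtain f' where f': "continuous_on (snd c ` (U \<inter> V)) f'"
      "\<And>q. q \<in> U \<inter> V \<Longrightarrow>
        ((snd d \<circ> inv_into U (snd c)) has_derivative blinfun_apply (f' (snd c q))) (at (snd c q))"
      using transition_C1[OF M c(1) d(1)] c(2) d(2) by metis
    have deriv: "transition_derivative c d q = blinfun_apply (f' (snd c q))" if "q \<in> U \<inter> V" for q
      using has_derivative_unique[OF transition_has_derivative[OF M c_at d_at]] f'(2) c(2) that by metis
    have "continuous_map ?X euclidean (snd c)"
      using chart_continuous[OF M c(1)] continuous_map_from_subtopology
      by (metis c(2) subtopology_subtopology)
    then have "continuous_map ?X (top_of_set (snd c ` (U \<inter> V))) (snd c)"
      by (rule continuous_map_into_subtopology) auto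
    then have "continuous_map ?X euclidean (f' \<circ> snd c)"
      using continuous_map_compose f'(1) continuous_map_iff_continuous by blast
    then have "continuous_map (prod_topology ?X euclidean) euclidean ((f' \<circ> snd c) \<circ> fst)"
      by (rule continuous_map_compose[OF continuous_map_fst])
    then have "continuous_map (prod_topology ?X euclidean) (prod_topology euclidean euclidean)
        (\<lambda>p. ((f' \<circ> snd c \<circ> fst) p, snd p))"
      by (intro continuous_map_pairedI continuous_map_snd)
    moreover have "continuous_map (prod_topology euclidean euclidean) euclidean
        (\<lambda>p :: ('b \<Rightarrow>\<^sub>L 'b) \<times> 'b. blinfun_apply (fst p) (snd p))"
      by (auto intro!: continuous_intros)
    ultimately have "continuous_map (prod_topology ?X euclidean) euclidean
        ((\<lambda>p. blinfun_apply (fst p) (snd p)) \<circ> (\<lambda>p. ((f' \<circ> snd c \<circ> fst) p, snd p)))"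
      by (rule continuous_map_compose)
    then show "continuous_map (prod_topology ?X euclidean) euclidean
        (\<lambda>(q, x). \<sigma> q (inv_into (fib ?T q) (\<tau> q) x))"
      by (rule continuous_map_eq)
        (use c_at d_at in \<open>auto simp: c(3) d(3) inv_into_tangent_coord[OF M] deriv\<close>)
  qed
qed

lemma tangent_bundle_obtain_chart:
  assumes M: "banach_manifold M" and q: "q \<in> points M"
  obtains c where "c \<in> charts_at M q" "fibre_chart (tangent_bundle M) q (\<lambda>v. v c)"
proof -
  obtain \<tau> where "\<tau> \<in> trivs_at (tangent_bundle M) q" "fibre_chart (tangent_bundle M) q \<tau>"
    by (rule vector_bundle_obtain_chart[OF tangent_bundle_vector_bundle[OF M] q])
  then show thesis using that unfolding trivs_at_tangent_bundle by blast
qed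

section \<open>Differentials and gradients\<close>

text \<open>The differential is defined by description; its value in coordinates is a Frechet derivative at
  an interior point, which is unique.\<close>
lemma differential_dual:
  assumes M: "banach_manifold M" and F: "differentiable_functional M F" and q: "q \<in> points M"
  shows "differential M F q \<in> dual (tangent_bundle M) q"
proof -
  obtain c where c: "c \<in> charts_at M q" "fibre_chart (tangent_bundle M) q (\<lambda>v. v c)"
    by (rule tangent_bundle_obtain_chart[OF M q])
  interpret fibre_chart "tangent_bundle M" q "\<lambda>v. v c" by (rule c(2))
  have "l = l'" if "has_differential M F q l" "has_differential M F q l'" for l l'
  proof (rule dual_eqI)
    show "l \<in> dual (tangent_bundle M) q" "l' \<in> dual (tangent_bundle M) q"
      using that unfolding has_differential_def by auto
    have "((F \<circ> inv_into (fst c) (snd c)) has_derivative (\<lambda>x. k (lift x))) (at (snd c q))"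
      if "has_differential M F q k" for k
      using that c(1) unfolding has_differential_def by (cases c) auto
    then have "(\<lambda>x. l (lift x)) = (\<lambda>x. l' (lift x))"
      using that has_derivative_unique by blast
    then show "l (lift x) = l' (lift x)" for x by metis
  qed
  moreover have "\<exists>l. has_differential M F q l"
    using F q unfolding differentiable_functional_def by blast
  ultimately have "has_differential M F q (differential M F q)"
    unfolding differential_def by (metis theI)
  then show ?thesis unfolding has_differential_def by blast
qed

lemma gradient_eq_riesz:
  assumes M: "banach_manifold M" and F: "differentiable_functional M F" and q: "q \<in> points M"
    and h: "inner_iso (tangent_bundle M) q (h q)"
  shows "gradient M h F q = inv_into (tangent_space M q) (h q) (differential M F q)"
proof -
  obtain c where "fibre_chart (tangent_bundle M) q (\<lambda>v. v c)"
    by (rule tangent_bundle_obtain_chart[OF M q])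
  then interpret fibre_chart "tangent_bundle M" q "\<lambda>v. v c" .
  note dF = differential_dual[OF M F q]
  show ?thesis
    unfolding gradient_def
  proof (rule the_equality)
    show "inv_into (tangent_space M q) (h q) (differential M F q) \<in> tangent_space M q \<and>
      (\<forall>u\<in>tangent_space M q. h q (inv_into (tangent_space M q) (h q) (differential M F q)) u =
         differential M F q u)"
      using riesz_mem[OF h dF] riesz_eq[OF h dF] by simp
    fix v
    assume v: "v \<in> tangent_space M q \<and> (\<forall>u\<in>tangent_space M q. h q v u = differential M F q u)"
    then have "h q v \<in> dual (tangent_bundle M) q"
      using h unfolding inner_iso_def by auto
    then have "h q v = differential M F q"
      using v dF lift_mem by (intro dual_eqI) auto
    then show "v = inv_into (tangent_space M q) (h q) (differential M F q)"
      using riesz_eqI[OF h, of v] v by simp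
  qed
qed

section \<open>Onsager systems\<close>

lemma onsager_fibre_map:
  assumes M: "banach_manifold M" and E: "vector_bundle (mtop M) E"
    and P: "bundle_hom (mtop M) E (tangent_bundle M) P" and surj: "surjective_process M E P"
    and q: "q \<in> points M"
  obtains \<tau> \<sigma> where "fibre_map E (tangent_bundle M) q \<tau> \<sigma> P"
proof -
  note T = tangent_bundle_vector_bundle[OF M]
  obtain \<tau> where \<tau>: "\<tau> \<in> trivs_at E q" "fibre_chart E q \<tau>"
    by (rule vector_bundle_obtain_chart[OF E q])
  obtain \<sigma> where \<sigma>: "\<sigma> \<in> trivs_at (tangent_bundle M) q" "fibre_chart (tangent_bundle M) q \<sigma>"
    by (rule vector_bundle_obtain_chart[OF T q])
  have "fibre_map E (tangent_bundle M) q \<tau> \<sigma> P"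
    using surj q bundle_hom_coord_bounded[OF E T P q \<tau>(1) \<sigma>(1)]
    by (intro fibre_map.intro \<tau> \<sigma> fibre_map_axioms.intro) (auto simp: surjective_process_def)
  then show thesis by (rule that)
qed

text \<open>The condition on a metric is pointwise, so the metric is assembled from the unique
  push-forward of the dissipation form in each tangent space.\<close>
lemma onsager_metric_ex1:
  assumes M: "banach_manifold M" and E: "vector_bundle (mtop M) E"
    and P: "bundle_hom (mtop M) E (tangent_bundle M) P" and surj: "surjective_process M E P"
    and D: "quadratic_dissipation (points M) E D"
  shows "\<exists>!h. onsager_metric M E D P h"
proof -
  let ?T = "tangent_bundle M"
  define is_push where "is_push q k \<longleftrightarrow> inner_iso ?T q k \<and>
     (\<forall>\<omega>\<^sub>1\<in>dual ?T q. \<forall>\<omega>\<^sub>2\<in>dual ?T q. inverse_form ?T q k \<omega>\<^sub>1 \<omega>\<^sub>2 =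
        inverse_form E q (flat E D q) (transpose_at E P q \<omega>\<^sub>1) (transpose_at E P q \<omega>\<^sub>2))" for q k
  have metric_iff: "onsager_metric M E D P h \<longleftrightarrow>
      h \<in> extensional (points M) \<and> (\<forall>q\<in>points M. is_push q (h q))" for h
    unfolding onsager_metric_def metric_on_def is_push_def by blast
  have ex1: "\<exists>!k. is_push q k" if q: "q \<in> points M" for q
  proof -
    obtain \<tau> \<sigma> where "fibre_map E ?T q \<tau> \<sigma> P"
      by (rule onsager_fibre_map[OF M E P surj q])
    then interpret fibre_map E ?T q \<tau> \<sigma> P .
    have g: "inner_iso E q (flat E D q)"
      using D q unfolding quadratic_dissipation_def by blast
    show ?thesis
    proof (rule ex_ex1I)
      show "\<exists>k. is_push q k"
        using push_forward_form_exists[OF g] unfolding is_push_def by metis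
      show "k = k'" if "is_push q k" "is_push q k'" for k k'
        using that unfolding is_push_def by (intro push_forward_form_unique[OF g]) auto
    qed
  qed
  show ?thesis
  proof (rule ex1I)
    show "onsager_metric M E D P (\<lambda>q\<in>points M. THE k. is_push q k)"
      unfolding metric_iff using theI'[OF ex1] by auto
    fix h assume h: "onsager_metric M E D P h"
    show "h = (\<lambda>q\<in>points M. THE k. is_push q k)"
    proof (rule extensionalityI[of _ "points M"])
      show "h q = (\<lambda>q\<in>points M. THE k. is_push q k) q" if "q \<in> points M" for q
        using h ex1[OF that] the1_equality that unfolding metric_iff by (metis restrict_apply')
    qed (use h metric_iff in auto)
  qed
qed

lemma curve_point: "\<lbrakk>differentiable_curve M I \<gamma>; t \<in> I\<rbrakk> \<Longrightarrow> \<gamma> t \<in> points M"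
  unfolding differentiable_curve_def continuous_map_def by auto

lemma is_arg_min_cong_on:
  assumes "\<And>w. Q w \<Longrightarrow> f w = g w"
  shows "is_arg_min f Q v \<longleftrightarrow> is_arg_min g Q v"
  using assms unfolding is_arg_min_def by metis

text \<open>The Rayleighian is the functional \<open>P\<^sup>T dF\<close> plus half of the dissipation form, so its
  minimiser is \<open>- \<sharp> P\<^sup>T dF\<close>.\<close>
lemma OVP_velocity:
  assumes M: "banach_manifold M" and E: "vector_bundle (mtop M) E"
    and P: "bundle_hom (mtop M) E (tangent_bundle M) P" and surj: "surjective_process M E P"
    and F: "differentiable_functional M F"
    and D: "quadratic_dissipation (points M) E D"
    and ovp: "satisfies_OVP M E F D P I \<gamma>" and t: "t \<in> I"
  shows "velocity M I \<gamma> t = neg_tangent M (\<gamma> t)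
           (P (\<gamma> t) (sharp E D (\<gamma> t) (transpose_at E P (\<gamma> t) (differential M F (\<gamma> t)))))"
proof -
  define q where "q = \<gamma> t"
  have q: "q \<in> points M"
    using ovp t curve_point unfolding satisfies_OVP_def q_def by blast
  obtain \<tau> \<sigma> where "fibre_map E (tangent_bundle M) q \<tau> \<sigma> P"
    by (rule onsager_fibre_map[OF M E P surj q])
  then interpret fibre_map E "tangent_bundle M" q \<tau> \<sigma> P .
  let ?l = "transpose_at E P q (differential M F q)"
  have g: "inner_iso E q (flat E D q)"
    and D_eq: "\<And>w. w \<in> fib E q \<Longrightarrow> D q w = 1/2 * flat E D q w w"
    using D q unfolding quadratic_dissipation_def by blast+
  have l: "?l \<in> dual E q"
    by (rule transpose_dual[OF differential_dual[OF M F q]])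
  obtain v where v: "is_arg_min (rayleighian M F D P q) (\<lambda>w. w \<in> fib E q) v"
      "velocity M I \<gamma> t = P q v"
    using ovp t unfolding satisfies_OVP_def q_def by blast
  have "is_arg_min (\<lambda>w. ?l w + 1/2 * flat E D q w w) (\<lambda>w. w \<in> fib E q) v"
    using v(1) by (rule is_arg_min_cong_on[THEN iffD1, rotated])
      (simp add: rayleighian_def transpose_at_def D_eq)
  then have "v = fscale E q (-1) (sharp E D q ?l)"
    using src.is_arg_min_linear_plus_half_form[OF g l] unfolding sharp_def by simp
  moreover have "sharp E D q ?l \<in> fib E q"
    unfolding sharp_def by (rule src.riesz_mem[OF g l])
  ultimately have "P q v = fscale (tangent_bundle M) q (-1) (P q (sharp E D q ?l))"
    using P q unfolding bundle_hom_def by blast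
  then show ?thesis using v(2) unfolding neg_tangent_def q_def by simp
qed

text \<open>The gradient is the inverse of the metric applied to the differential, and this inverse is
  \<open>P \<sharp> P\<^sup>T\<close>.\<close>
lemma onsager_gradient:
  assumes M: "banach_manifold M" and E: "vector_bundle (mtop M) E"
    and P: "bundle_hom (mtop M) E (tangent_bundle M) P" and surj: "surjective_process M E P"
    and F: "differentiable_functional M F"
    and D: "quadratic_dissipation (points M) E D"
    and h: "onsager_metric M E D P h" and q: "q \<in> points M"
  shows "gradient M h F q = P q (sharp E D q (transpose_at E P q (differential M F q)))"
proof -
  obtain \<tau> \<sigma> where "fibre_map E (tangent_bundle M) q \<tau> \<sigma> P"
    by (rule onsager_fibre_map[OF M E P surj q])
  then interpret fibre_map E "tangent_bundle M" q \<tau> \<sigma> P .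
  have g: "inner_iso E q (flat E D q)"
    using D q unfolding quadratic_dissipation_def by blast
  have hq: "inner_iso (tangent_bundle M) q (h q)"
    using h q unfolding onsager_metric_def metric_on_def by blast
  have "inv_into (fib (tangent_bundle M) q) (h q) (differential M F q) =
      P q (inv_into (fib E q) (flat E D q) (transpose_at E P q (differential M F q)))"
    using h q by (intro push_forward_riesz[OF g hq _ differential_dual[OF M F q]])
      (simp add: onsager_metric_def)
  then show ?thesis
    by (simp add: gradient_eq_riesz[where h = h, OF M F q hq] sharp_def)
qed

lemma gradient_flow_onsager_system:
  assumes M: "banach_manifold M" and F: "differentiable_functional M F" and h: "metric_on M h"
  shows "onsager_system M (tangent_bundle M) F (\<lambda>q w. 1/2 * h q w w) (\<lambda>q w. w)"
  unfolding onsager_system_def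
proof (intro conjI)
  let ?T = "tangent_bundle M"
  show T: "vector_bundle (mtop M) ?T" by (rule tangent_bundle_vector_bundle[OF M])
  show "bundle_hom (mtop M) ?T ?T (\<lambda>q w. w)" by (rule vector_bundle_imp_identity_hom[OF T])
  show "\<forall>q\<in>points M. (\<forall>w\<in>fib ?T q. 0 \<le> 1/2 * h q w w) \<and>
      1/2 * h q (fzero ?T q) (fzero ?T q) = 0 \<and>
      (\<forall>u\<in>fib ?T q. \<forall>v\<in>fib ?T q. \<forall>s\<in>{0..1}.
        1/2 * h q (fadd ?T q (fscale ?T q (1 - s) u) (fscale ?T q s v))
          (fadd ?T q (fscale ?T q (1 - s) u) (fscale ?T q s v))
        \<le> (1 - s) * (1/2 * h q u u) + s * (1/2 * h q v v))"
  proof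
    fix q assume q: "q \<in> points M"
    obtain \<sigma> where "fibre_chart ?T q \<sigma>"
      by (rule vector_bundle_obtain_chart[OF T q])
    then interpret fibre_chart ?T q \<sigma> .
    have hq: "inner_iso ?T q (h q)" using h q unfolding metric_on_def by blast
    show "(\<forall>w\<in>fib ?T q. 0 \<le> 1/2 * h q w w) \<and>
      1/2 * h q (fzero ?T q) (fzero ?T q) = 0 \<and>
      (\<forall>u\<in>fib ?T q. \<forall>v\<in>fib ?T q. \<forall>s\<in>{0..1}.
        1/2 * h q (fadd ?T q (fscale ?T q (1 - s) u) (fscale ?T q s v))
          (fadd ?T q (fscale ?T q (1 - s) u) (fscale ?T q s v))
        \<le> (1 - s) * (1/2 * h q u u) + s * (1/2 * h q v v))"
      using inner_iso_nonneg[OF hq] inner_iso_zero[OF hq] inner_iso_convex[OF hq] by fastforce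
  qed
qed (use assms in auto)

text \<open>With \<open>P\<close> the identity, the Rayleighian is \<open>dF w + h w w / 2\<close>, whose minimiser is minus
  the gradient.\<close>
lemma gradient_flow_satisfies_OVP:
  assumes M: "banach_manifold M" and F: "differentiable_functional M F" and h: "metric_on M h"
    and flow: "gradient_flow M h F I \<gamma>"
  shows "satisfies_OVP M (tangent_bundle M) F (\<lambda>q w. 1/2 * h q w w) (\<lambda>q w. w) I \<gamma>"
  unfolding satisfies_OVP_def
proof (intro conjI ballI)
  let ?T = "tangent_bundle M"
  show curve: "differentiable_curve M I \<gamma>" using flow unfolding gradient_flow_def by blast
  fix t assume t: "t \<in> I"
  have q: "\<gamma> t \<in> points M" by (rule curve_point[OF curve t])
  obtain \<sigma> where "fibre_chart ?T (\<gamma> t) \<sigma>"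
    by (rule vector_bundle_obtain_chart[OF tangent_bundle_vector_bundle[OF M] q])
  then interpret fibre_chart ?T "\<gamma> t" \<sigma> .
  have hq: "inner_iso ?T (\<gamma> t) (h (\<gamma> t))" using h q unfolding metric_on_def by blast
  have "velocity M I \<gamma> t =
      fscale ?T (\<gamma> t) (-1) (inv_into (fib ?T (\<gamma> t)) (h (\<gamma> t)) (differential M F (\<gamma> t)))"
    using flow t gradient_eq_riesz[where h = h, OF M F q hq] unfolding gradient_flow_def neg_tangent_def by simp
  then have "is_arg_min (\<lambda>w. differential M F (\<gamma> t) w + 1/2 * h (\<gamma> t) w w)
      (\<lambda>w. w \<in> fib ?T (\<gamma> t)) (velocity M I \<gamma> t)"
    using is_arg_min_linear_plus_half_form[OF hq differential_dual[OF M F q]] by blast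
  then show "\<exists>v. is_arg_min (rayleighian M F (\<lambda>q w. 1/2 * h q w w) (\<lambda>q w. w) (\<gamma> t))
      (\<lambda>w. w \<in> fib ?T (\<gamma> t)) v \<and> velocity M I \<gamma> t = v"
    unfolding rayleighian_def by blast
qed

theorem theorem2p2:
  fixes M :: "('q, 'b::banach) manifold"
    and E :: "('q, 'e, 'f::banach) vbundle"
    and F :: "'q \<Rightarrow> real"
    and D :: "'q \<Rightarrow> 'e \<Rightarrow> real"
    and P :: "'q \<Rightarrow> 'e \<Rightarrow> ('q, 'b) chart \<Rightarrow> 'b"
  shows
    "(onsager_system M E F D P \<and> quadratic_dissipation (points M) E D \<and> surjective_process M E P
       \<longrightarrow> (\<exists>!h. onsager_metric M E D P h) \<and>
           (\<forall>h I \<gamma>. onsager_metric M E D P h \<and> satisfies_OVP M E F D P I \<gamma> \<longrightarrow>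
              (\<forall>t\<in>I. velocity M I \<gamma> t =
                 neg_tangent M (\<gamma> t)
                   (P (\<gamma> t) (sharp E D (\<gamma> t)
                      (transpose_at E P (\<gamma> t) (differential M F (\<gamma> t)))))) \<and>
              gradient_flow M h F I \<gamma>))
     \<and>
     (\<forall>h I \<gamma>. banach_manifold M \<and> differentiable_functional M F \<and> metric_on M h \<and>
         gradient_flow M h F I \<gamma>
       \<longrightarrow> onsager_system M (tangent_bundle M) F (\<lambda>q w. 1/2 * h q w w) (\<lambda>q w. w) \<and>
           satisfies_OVP M (tangent_bundle M) F (\<lambda>q w. 1/2 * h q w w) (\<lambda>q w. w) I \<gamma>)"
proof (intro conjI impI allI; elim conjE)
  assume sys: "onsager_system M E F D P" and D: "quadratic_dissipation (points M) E D"
    and surj: "surjective_process M E P"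
  have M: "banach_manifold M" and E: "vector_bundle (mtop M) E"
    and F: "differentiable_functional M F"
    and P: "bundle_hom (mtop M) E (tangent_bundle M) P"
    using sys unfolding onsager_system_def by auto
  show "\<exists>!h. onsager_metric M E D P h"
    by (rule onsager_metric_ex1[OF M E P surj D])
  fix h I \<gamma> assume h: "onsager_metric M E D P h" and ovp: "satisfies_OVP M E F D P I \<gamma>"
  note vel = OVP_velocity[OF M E P surj F D ovp]
  show "\<forall>t\<in>I. velocity M I \<gamma> t = neg_tangent M (\<gamma> t)
      (P (\<gamma> t) (sharp E D (\<gamma> t) (transpose_at E P (\<gamma> t) (differential M F (\<gamma> t)))))"
    using vel by blast
  have curve: "differentiable_curve M I \<gamma>" using ovp unfolding satisfies_OVP_def by blast
  show "gradient_flow M h F I \<gamma>"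
    unfolding gradient_flow_def
    using curve vel onsager_gradient[OF M E P surj F D h curve_point[OF curve]] by simp
next
  fix h I \<gamma>
  assume "banach_manifold M" "differentiable_functional M F" "metric_on M h" "gradient_flow M h F I \<gamma>"
  then show "onsager_system M (tangent_bundle M) F (\<lambda>q w. 1/2 * h q w w) (\<lambda>q w. w)"
    and "satisfies_OVP M (tangent_bundle M) F (\<lambda>q w. 1/2 * h q w w) (\<lambda>q w. w) I \<gamma>"
    using gradient_flow_onsager_system gradient_flow_satisfies_OVP by blast+
qed

end
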